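(* Let $A$ be a free triassociative algebra over a field $K$. Then $H^n_{\mathrm{Trias}}(A,M)=0$ for all $n\ge 2$ and every $A$-representation $M$.
   Context: All vector spaces and tensor products are over a fixed field $K$. A triassociative algebra is a vector space $A$ with three bilinear operations $\dashv,\vdash,\bot$ satisfying for all $x,y,z$: (1) $(x\dashv y)\dashv z=x\dashv(y\dashv z)$; (2) $(x\dashv y)\dashv z=x\dashv(y\vdash z)$; (3) $(x\vdash y)\dashv z=x\vdash(y\dashv z)$; (4) $(x\dashv y)\vdash z=x\vdash(y\vdash z)$; (5) $(x\vdash y)\vdash z=x\vdash(y\vdash z)$; (6) $(x\dashv y)\dashv z=x\dashv(y\,\bot\, z)$; (7) $(x\,\bot\, y)\dashv z=x\,\bot\,(y\dashv z)$; (8) $(x\dashv y)\,\bot\, z=x\,\bot\,(y\vdash z)$; (9) $(x\vdash y)\,\bot\, z=x\vdash(y\,\bot\, z)$; (10) $(x\,\bot\, y)\vdash z=x\vdash(y\vdash z)$; (11) $(x\,\bot\, y)\,\bot\, z=x\,\bot\,(y\,\bot\, z)$. Morphisms are linear maps respecting the three products; free triassociative algebras are free (on a vector space) in this category. An $A$-representation is a vector space $M$ with bilinear left operations $\dashv,\vdash,\bot\colon A\otimes M\to M$ and right operations $\dashv,\vdash,\bot\colon M\otimes A\to M$ satisfying (1)-(11) whenever exactly one of $x,y,z$ is from $M$ and the other two are from $A$. Trees. $T_n$ ($n\ge0$) is the set of planar rooted trees with $n+1$ leaves in which every internal vertex has at least $2$ incoming edges ($T_0=\{|\}$, no internal vertex);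 $\psi\in T_n$ has degree $|\psi|=n$; leaves are numbered $0,\dots,n$ from left to right. The grafting $\psi_0\vee\cdots\vee\psi_k$ is obtained by arranging the trees from left to right and joining their roots to a new lowest internal vertex, connected to a new root; every tree of degree $\ge 1$ is uniquely of this form with $k\ge1$. A leaf is left (resp. right) oriented if it is the leftmost (resp. rightmost) incoming edge of the vertex it is attached to; otherwise it is a middle leaf. $d_i\colon T_{n+1}\to T_n$ deletes the $i$th leaf (suppressing any vertex left with one incoming edge). For $\psi=\psi_0\vee\cdots\vee\psi_k\in T_{n+1}$ and $0\le i\le n+1$ define $\circ_i^\psi\in\{\dashv,\vdash,\bot\}$ by: $\circ_0^\psi$ is $\dashv$ if $|\psi_0|=0$ and $k=1$; $\vdash$ if $|\psi_0|>0$; $\bot$ if $|\psi_0|=0$ and $k>1$. For $1\le i\le n$, $\circ_i^\psi$ is $\dashv$, $\vdash$, or $\bot$ according as the $i$th leaf is left oriented, right oriented, or a middle leaf. $\circ_{n+1}^\psi$ is $\dashv$ if $|\psi_k|>0$; $\vdash$ if $k=1$ and $|\psi_1|=0$; $\bot$ if $k>1$ and $|\psi_k|=0$. Cohomology. $C^n_{\mathrm{Trias}}(A,M)=\mathrm{Hom}_K(K[T_n]\otimes A^{\otimes n},M)$ for $n\ge 0$, with coboundary $\delta^n=\sum_{i=0}^{n+1}(-1)^i\delta_i^n\colon C^n_{\mathrm{Trias}}(A,M)\to C^{n+1}_{\mathrm{Trias}}(A,M)$, where for $\psi\in T_{n+1}$, $a_1,\dots,a_{n+1}\in A$: $(\delta_0^nf)(\psi;a_1,\dots,a_{n+1})=a_1\circ_0^\psi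 f(d_0\psi;a_2,\dots,a_{n+1})$; $(\delta_i^nf)(\psi;a_1,\dots,a_{n+1})=f(d_i\psi;a_1,\dots,a_i\circ_i^\psi a_{i+1},\dots,a_{n+1})$ for $1\le i\le n$; $(\delta_{n+1}^nf)(\psi;a_1,\dots,a_{n+1})=f(d_{n+1}\psi;a_1,\dots,a_n)\circ_{n+1}^\psi a_{n+1}$. This is a cochain complex, and $H^n_{\mathrm{Trias}}(A,M)$ is its $n$th cohomology. *)

theory Defs
  imports Complex_Main "HOL-Library.Poly_Mapping" "HOL-Library.Countable"
begin

section \<open>Triassociative algebras\<close>

datatype triop = Lft  \<comment> \<open>the product \<open>\<stileturn>\<close>\<close>
  | Rgt  \<comment> \<open>the product \<open>\<turnstile>\<close>\<close>
  | Mid  \<comment> \<open>the product \<open>\<bottom>\<close>\<close>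

definition bilinear_op ::
  "('k::field \<Rightarrow> 'x::ab_group_add \<Rightarrow> 'x) \<Rightarrow> ('k \<Rightarrow> 'y::ab_group_add \<Rightarrow> 'y) \<Rightarrow>
   ('k \<Rightarrow> 'z::ab_group_add \<Rightarrow> 'z) \<Rightarrow> ('x \<Rightarrow> 'y \<Rightarrow> 'z) \<Rightarrow> bool" where
  "bilinear_op sX sY sZ b \<longleftrightarrow>
     (\<forall>x. Vector_Spaces.linear sY sZ (b x)) \<and> (\<forall>y. Vector_Spaces.linear sX sZ (\<lambda>x. b x y))"

text \<open>The eleven triassociative identities for \<open>x\<close>, \<open>y\<close>, \<open>z\<close> taken from three possibly
  different spaces. Every identity has the form \<open>(x \<circ> y) \<circ> z = x \<circ> (y \<circ> z)\<close>; the products in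
  \<open>x \<circ> y\<close>, \<open>(x \<circ> y) \<circ> z\<close>, \<open>y \<circ> z\<close> and \<open>x \<circ> (y \<circ> z)\<close> are \<open>p\<close>, \<open>q\<close>, \<open>r\<close> and \<open>s\<close>.\<close>

definition triassoc ::
  "(triop \<Rightarrow> 'x \<Rightarrow> 'y \<Rightarrow> 'xy) \<Rightarrow> (triop \<Rightarrow> 'xy \<Rightarrow> 'z \<Rightarrow> 'w) \<Rightarrow>
   (triop \<Rightarrow> 'y \<Rightarrow> 'z \<Rightarrow> 'yz) \<Rightarrow> (triop \<Rightarrow> 'x \<Rightarrow> 'yz \<Rightarrow> 'w) \<Rightarrow> bool" where
  "triassoc p q r s \<longleftrightarrow> (\<forall>x y z.
     q Lft (p Lft x y) z = s Lft x (r Lft y z) \<and>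
     q Lft (p Lft x y) z = s Lft x (r Rgt y z) \<and>
     q Lft (p Rgt x y) z = s Rgt x (r Lft y z) \<and>
     q Rgt (p Lft x y) z = s Rgt x (r Rgt y z) \<and>
     q Rgt (p Rgt x y) z = s Rgt x (r Rgt y z) \<and>
     q Lft (p Lft x y) z = s Lft x (r Mid y z) \<and>
     q Lft (p Mid x y) z = s Mid x (r Lft y z) \<and>
     q Mid (p Lft x y) z = s Mid x (r Rgt y z) \<and>
     q Mid (p Rgt x y) z = s Rgt x (r Mid y z) \<and>
     q Rgt (p Mid x y) z = s Rgt x (r Rgt y z) \<and>
     q Mid (p Mid x y) z = s Mid x (r Mid y z))"

definition triassociative_algebra ::
  "('k::field \<Rightarrow> 'a::ab_group_add \<Rightarrow> 'a) \<Rightarrow> (triop \<Rightarrow> 'a \<Rightarrow> 'a \<Rightarrow> 'a) \<Rightarrow> bool" where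
  "triassociative_algebra sA pr \<longleftrightarrow>
     vector_space sA \<and> (\<forall>c. bilinear_op sA sA sA (pr c)) \<and> triassoc pr pr pr pr"

definition triassociative_hom ::
  "('k::field \<Rightarrow> 'a::ab_group_add \<Rightarrow> 'a) \<Rightarrow> (triop \<Rightarrow> 'a \<Rightarrow> 'a \<Rightarrow> 'a) \<Rightarrow>
   ('k \<Rightarrow> 'b::ab_group_add \<Rightarrow> 'b) \<Rightarrow> (triop \<Rightarrow> 'b \<Rightarrow> 'b \<Rightarrow> 'b) \<Rightarrow> ('a \<Rightarrow> 'b) \<Rightarrow> bool" where
  "triassociative_hom sA prA sB prB h \<longleftrightarrow>
     Vector_Spaces.linear sA sB h \<and> (\<forall>c x y. h (prA c x y) = prB c (h x) (h y))"

text \<open>\<open>lact\<close> are the products \<open>A \<otimes> M \<rightarrow> M\<close> and \<open>ract\<close> the products \<open>M \<otimes> A \<rightarrow> M\<close>. The last three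
  conditions are the identities with \<open>x\<close>, \<open>y\<close>, \<open>z\<close> from \<open>M\<close>, respectively.\<close>

definition triassociative_representation ::
  "('k::field \<Rightarrow> 'a::ab_group_add \<Rightarrow> 'a) \<Rightarrow> (triop \<Rightarrow> 'a \<Rightarrow> 'a \<Rightarrow> 'a) \<Rightarrow>
   ('k \<Rightarrow> 'm::ab_group_add \<Rightarrow> 'm) \<Rightarrow> (triop \<Rightarrow> 'a \<Rightarrow> 'm \<Rightarrow> 'm) \<Rightarrow> (triop \<Rightarrow> 'm \<Rightarrow> 'a \<Rightarrow> 'm) \<Rightarrow> bool"
  where
  "triassociative_representation sA pr sM lact ract \<longleftrightarrow>
     vector_space sM \<and>
     (\<forall>c. bilinear_op sA sM sM (lact c)) \<and> (\<forall>c. bilinear_op sM sA sM (ract c)) \<and>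
     triassoc ract ract pr ract \<and>
     triassoc lact ract ract lact \<and>
     triassoc pr lact lact lact"


section \<open>Free triassociative algebras\<close>

definition free_extension ::
  "('k::field \<Rightarrow> 'v::ab_group_add \<Rightarrow> 'v) \<Rightarrow> ('k \<Rightarrow> 'a::ab_group_add \<Rightarrow> 'a) \<Rightarrow>
   (triop \<Rightarrow> 'a \<Rightarrow> 'a \<Rightarrow> 'a) \<Rightarrow> ('v \<Rightarrow> 'a) \<Rightarrow> ('k \<Rightarrow> 'b::ab_group_add \<Rightarrow> 'b) \<Rightarrow>
   (triop \<Rightarrow> 'b \<Rightarrow> 'b \<Rightarrow> 'b) \<Rightarrow> bool" where
  "free_extension sV sA pr \<iota> sB prB \<longleftrightarrow>
     (\<forall>g. Vector_Spaces.linear sV sB g \<longrightarrow>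
        (\<exists>!h. triassociative_hom sA pr sB prB h \<and> (\<forall>v. h (\<iota> v) = g v)))"

text \<open>\<open>A\<close> is free on the vector space \<open>V\<close> via \<open>\<iota>\<close>. HOL cannot quantify over types inside a
  definition, so the universal property is required for all triassociative algebras on one
  space with a basis of \<open>\<aleph>\<^sub>0 \<cdot> |A|\<close> elements. This is not a restriction: the lemma
  \<open>free_triassociative_algebra_extension\<close> below derives the universal property for algebras
  on arbitrary types.\<close>

definition free_triassociative_algebra ::
  "('k::field \<Rightarrow> 'v::ab_group_add \<Rightarrow> 'v) \<Rightarrow> ('k \<Rightarrow> 'a::ab_group_add \<Rightarrow> 'a) \<Rightarrow>
   (triop \<Rightarrow> 'a \<Rightarrow> 'a \<Rightarrow> 'a) \<Rightarrow> ('v \<Rightarrow> 'a) \<Rightarrow> bool" where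
  "free_triassociative_algebra sV sA pr \<iota> \<longleftrightarrow>
     vector_space sV \<and> triassociative_algebra sA pr \<and> Vector_Spaces.linear sV sA \<iota> \<and>
     (\<forall>(sB :: 'k \<Rightarrow> (('a list \<times> nat) \<Rightarrow>\<^sub>0 'k) \<Rightarrow> (('a list \<times> nat) \<Rightarrow>\<^sub>0 'k)) prB.
        triassociative_algebra sB prB \<longrightarrow> free_extension sV sA pr \<iota> sB prB)"


section \<open>Planar trees\<close>

text \<open>\<open>Node [\<psi>\<^sub>0, \<dots>, \<psi>\<^sub>k]\<close> is the grafting \<open>\<psi>\<^sub>0 \<or> \<dots> \<or> \<psi>\<^sub>k\<close>, and \<open>Leaf\<close> is the tree \<open>|\<close>.\<close>

datatype ptree = Leaf | Node "ptree list"

fun leaves :: "ptree \<Rightarrow> nat" where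
  "leaves Leaf = 1"
| "leaves (Node ts) = sum_list (map leaves ts)"

definition tree_degree :: "ptree \<Rightarrow> nat" where
  "tree_degree t = leaves t - 1"

fun wf_tree :: "ptree \<Rightarrow> bool" where
  "wf_tree Leaf = True"
| "wf_tree (Node ts) = (length ts \<ge> 2 \<and> (\<forall>t\<in>set ts. wf_tree t))"

definition trees :: "nat \<Rightarrow> ptree set" where
  "trees n = {t. wf_tree t \<and> leaves t = n + 1}"

fun suppress :: "ptree list \<Rightarrow> ptree" where
  "suppress [t] = t"
| "suppress ts = Node ts"

text \<open>\<open>del_leaf i t\<close> is \<open>d\<^sub>i t\<close> (the value at \<open>Leaf\<close> is a dummy).\<close>

fun del_leaf :: "nat \<Rightarrow> ptree \<Rightarrow> ptree"
  and del_forest :: "nat \<Rightarrow> ptree list \<Rightarrow> ptree list" where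
  "del_leaf i Leaf = Leaf"
| "del_leaf i (Node ts) = suppress (del_forest i ts)"
| "del_forest i [] = []"
| "del_forest i (t # ts) =
     (if i < leaves t then (if t = Leaf then ts else del_leaf i t # ts)
      else t # del_forest (i - leaves t) ts)"

text \<open>The product attached to the orientation of the \<open>i\<close>th leaf. The flag \<open>b\<close> records whether
  the list of subtrees starts with the leftmost incoming edge of its vertex; the values at
  \<open>Leaf\<close> and \<open>[]\<close> are dummies.\<close>

fun leaf_op :: "nat \<Rightarrow> ptree \<Rightarrow> triop"
  and leaf_op_forest :: "bool \<Rightarrow> nat \<Rightarrow> ptree list \<Rightarrow> triop" where
  "leaf_op i Leaf = Mid"
| "leaf_op i (Node ts) = leaf_op_forest True i ts"
| "leaf_op_forest b i [] = Mid"
| "leaf_op_forest b i (t # ts) =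
     (if i < leaves t
      then (if t = Leaf then (if b then Lft else if ts = [] then Rgt else Mid) else leaf_op i t)
      else leaf_op_forest False (i - leaves t) ts)"

fun first_op :: "ptree \<Rightarrow> triop" where
  "first_op (Node ts) =
     (if tree_degree (hd ts) > 0 then Rgt else if length ts = 2 then Lft else Mid)"
| "first_op Leaf = Mid"

fun last_op :: "ptree \<Rightarrow> triop" where
  "last_op (Node ts) =
     (if tree_degree (last ts) > 0 then Lft else if length ts = 2 then Rgt else Mid)"
| "last_op Leaf = Mid"

definition tree_op :: "nat \<Rightarrow> ptree \<Rightarrow> triop" where
  "tree_op i t = (if i = 0 then first_op t else if i = tree_degree t then last_op t else leaf_op i t)"


section \<open>Cohomology\<close>

text \<open>A linear map \<open>K[T\<^sub>n] \<otimes> A\<^sup>\<otimes>\<^sup>n \<rightarrow> M\<close> is given by its values \<open>f \<psi> [a\<^sub>1, \<dots>, a\<^sub>n]\<close>, which are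
  multilinear in the \<open>a\<^sub>j\<close> for every \<open>\<psi> \<in> T\<^sub>n\<close>; outside these arguments \<open>f\<close> is set to \<open>0\<close>, so that
  different functions are different linear maps.\<close>

definition cochains ::
  "('k::field \<Rightarrow> 'a::ab_group_add \<Rightarrow> 'a) \<Rightarrow> ('k \<Rightarrow> 'm::ab_group_add \<Rightarrow> 'm) \<Rightarrow> nat \<Rightarrow>
   (ptree \<Rightarrow> 'a list \<Rightarrow> 'm) set" where
  "cochains sA sM n = {f.
     (\<forall>\<psi>\<in>trees n. \<forall>as. length as = n \<longrightarrow>
        (\<forall>j<n. Vector_Spaces.linear sA sM (\<lambda>x. f \<psi> (as[j := x])))) \<and>
     (\<forall>\<psi> as. \<psi> \<notin> trees n \<or> length as \<noteq> n \<longrightarrow> f \<psi> as = 0)}"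

text \<open>Lists are indexed from \<open>0\<close>, so \<open>a\<^sub>i\<close> is \<open>as ! (i - 1)\<close>.\<close>

definition coface ::
  "(triop \<Rightarrow> 'a \<Rightarrow> 'a \<Rightarrow> 'a) \<Rightarrow> (triop \<Rightarrow> 'a \<Rightarrow> 'm \<Rightarrow> 'm) \<Rightarrow> (triop \<Rightarrow> 'm \<Rightarrow> 'a \<Rightarrow> 'm) \<Rightarrow> nat \<Rightarrow> nat \<Rightarrow>
   (ptree \<Rightarrow> 'a list \<Rightarrow> 'm) \<Rightarrow> ptree \<Rightarrow> 'a list \<Rightarrow> 'm" where
  "coface pr lact ract n i f \<psi> as =
     (if i = 0 then lact (tree_op 0 \<psi>) (hd as) (f (del_leaf 0 \<psi>) (tl as))
      else if i \<le> n then
        f (del_leaf i \<psi>)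
          (take (i - 1) as @ pr (tree_op i \<psi>) (as ! (i - 1)) (as ! i) # drop (i + 1) as)
      else ract (tree_op (n + 1) \<psi>) (f (del_leaf (n + 1) \<psi>) (butlast as)) (last as))"

definition coboundary ::
  "(triop \<Rightarrow> 'a \<Rightarrow> 'a \<Rightarrow> 'a) \<Rightarrow> ('k::field \<Rightarrow> 'm::ab_group_add \<Rightarrow> 'm) \<Rightarrow>
   (triop \<Rightarrow> 'a \<Rightarrow> 'm \<Rightarrow> 'm) \<Rightarrow> (triop \<Rightarrow> 'm \<Rightarrow> 'a \<Rightarrow> 'm) \<Rightarrow> nat \<Rightarrow>
   (ptree \<Rightarrow> 'a list \<Rightarrow> 'm) \<Rightarrow> ptree \<Rightarrow> 'a list \<Rightarrow> 'm" where
  "coboundary pr sM lact ract n f \<psi> as =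
     (if \<psi> \<in> trees (n + 1) \<and> length as = n + 1
      then \<Sum>i\<le>n + 1. sM ((- 1) ^ i) (coface pr lact ract n i f \<psi> as)
      else 0)"

definition cocycles ::
  "('k::field \<Rightarrow> 'a::ab_group_add \<Rightarrow> 'a) \<Rightarrow> (triop \<Rightarrow> 'a \<Rightarrow> 'a \<Rightarrow> 'a) \<Rightarrow>
   ('k \<Rightarrow> 'm::ab_group_add \<Rightarrow> 'm) \<Rightarrow> (triop \<Rightarrow> 'a \<Rightarrow> 'm \<Rightarrow> 'm) \<Rightarrow> (triop \<Rightarrow> 'm \<Rightarrow> 'a \<Rightarrow> 'm) \<Rightarrow> nat \<Rightarrow>
   (ptree \<Rightarrow> 'a list \<Rightarrow> 'm) set" where
  "cocycles sA pr sM lact ract n =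
     {f \<in> cochains sA sM n. coboundary pr sM lact ract n f = (\<lambda>\<psi> as. 0)}"

fun coboundaries ::
  "('k::field \<Rightarrow> 'a::ab_group_add \<Rightarrow> 'a) \<Rightarrow> (triop \<Rightarrow> 'a \<Rightarrow> 'a \<Rightarrow> 'a) \<Rightarrow>
   ('k \<Rightarrow> 'm::ab_group_add \<Rightarrow> 'm) \<Rightarrow> (triop \<Rightarrow> 'a \<Rightarrow> 'm \<Rightarrow> 'm) \<Rightarrow> (triop \<Rightarrow> 'm \<Rightarrow> 'a \<Rightarrow> 'm) \<Rightarrow> nat \<Rightarrow>
   (ptree \<Rightarrow> 'a list \<Rightarrow> 'm) set" where
  "coboundaries sA pr sM lact ract 0 = {\<lambda>\<psi> as. 0}"
| "coboundaries sA pr sM lact ract (Suc n) = coboundary pr sM lact ract n ` cochains sA sM n"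

definition cohomology_class ::
  "('k::field \<Rightarrow> 'a::ab_group_add \<Rightarrow> 'a) \<Rightarrow> (triop \<Rightarrow> 'a \<Rightarrow> 'a \<Rightarrow> 'a) \<Rightarrow>
   ('k \<Rightarrow> 'm::ab_group_add \<Rightarrow> 'm) \<Rightarrow> (triop \<Rightarrow> 'a \<Rightarrow> 'm \<Rightarrow> 'm) \<Rightarrow> (triop \<Rightarrow> 'm \<Rightarrow> 'a \<Rightarrow> 'm) \<Rightarrow> nat \<Rightarrow>
   (ptree \<Rightarrow> 'a list \<Rightarrow> 'm) \<Rightarrow> (ptree \<Rightarrow> 'a list \<Rightarrow> 'm) set" where
  "cohomology_class sA pr sM lact ract n f =
     {\<lambda>\<psi> as. f \<psi> as + b \<psi> as | b. b \<in> coboundaries sA pr sM lact ract n}"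

text \<open>The underlying set of the quotient space of cocycles modulo coboundaries.\<close>

definition H_Trias ::
  "('k::field \<Rightarrow> 'a::ab_group_add \<Rightarrow> 'a) \<Rightarrow> (triop \<Rightarrow> 'a \<Rightarrow> 'a \<Rightarrow> 'a) \<Rightarrow>
   ('k \<Rightarrow> 'm::ab_group_add \<Rightarrow> 'm) \<Rightarrow> (triop \<Rightarrow> 'a \<Rightarrow> 'm \<Rightarrow> 'm) \<Rightarrow> (triop \<Rightarrow> 'm \<Rightarrow> 'a \<Rightarrow> 'm) \<Rightarrow> nat \<Rightarrow>
   (ptree \<Rightarrow> 'a list \<Rightarrow> 'm) set set" where
  "H_Trias sA pr sM lact ract n =
     cohomology_class sA pr sM lact ract n ` cocycles sA pr sM lact ract n"

section \<open>The universal property for arbitrary types\<close>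

text \<open>Formal monomials in elements of \<open>V\<close>. Their values span the subalgebra generated by \<open>V\<close>, and
  there are at most as many of them as elements of \<open>'a list \<times> nat\<close>.\<close>

datatype 'v tmono = Gen 'v | Prod triop "'v tmono" "'v tmono"

instance triop :: countable by countable_datatype
instance tmono :: (countable) countable by countable_datatype

primrec mono_list :: "'v tmono \<Rightarrow> 'v list" where
  "mono_list (Gen v) = [v]"
| "mono_list (Prod c x y) = mono_list x @ mono_list y"

primrec mono_shape :: "'v tmono \<Rightarrow> unit tmono" where
  "mono_shape (Gen v) = Gen ()"
| "mono_shape (Prod c x y) = Prod c (mono_shape x) (mono_shape y)"

primrec mono_eval :: "(triop \<Rightarrow> 'c \<Rightarrow> 'c \<Rightarrow> 'c) \<Rightarrow> ('v \<Rightarrow> 'c) \<Rightarrow> 'v tmono \<Rightarrow> 'c" where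
  "mono_eval pr g (Gen v) = g v"
| "mono_eval pr g (Prod c x y) = pr c (mono_eval pr g x) (mono_eval pr g y)"

lemma mono_shape_length:
  "mono_shape x = mono_shape y \<Longrightarrow> length (mono_list x) = length (mono_list y)"
proof (induction x arbitrary: y)
  case (Gen v) then show ?case by (cases y) auto
next
  case (Prod c x1 x2) then show ?case by (cases y) auto
qed

lemma mono_inject:
  "mono_shape x = mono_shape y \<Longrightarrow> mono_list x = mono_list y \<Longrightarrow> x = y"
proof (induction x arbitrary: y)
  case (Gen v) then show ?case by (cases y) auto
next
  case (Prod c x1 x2)
  then obtain y1 y2 where y: "y = Prod c y1 y2" "mono_shape x1 = mono_shape y1"
      "mono_shape x2 = mono_shape y2"
    by (cases y) auto
  then show ?case using Prod mono_shape_length[of x1 y1] by auto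
qed

definition pm_scale :: "'k::field \<Rightarrow> ('i \<Rightarrow>\<^sub>0 'k) \<Rightarrow> ('i \<Rightarrow>\<^sub>0 'k)" where
  "pm_scale r = Poly_Mapping.map ((*) r)"

lemma lookup_pm_scale: "Poly_Mapping.lookup (pm_scale r p) x = r * Poly_Mapping.lookup p x"
  by (simp add: pm_scale_def Poly_Mapping.map.rep_eq when_def)

lemma vector_space_pm: "vector_space (pm_scale :: 'k::field \<Rightarrow> ('i \<Rightarrow>\<^sub>0 'k) \<Rightarrow> _)"
  by unfold_locales (auto intro!: poly_mapping_eqI simp: lookup_pm_scale lookup_add algebra_simps)

definition pm_eval :: "('k::field \<Rightarrow> 'c::ab_group_add \<Rightarrow> 'c) \<Rightarrow> ('i \<Rightarrow> 'c) \<Rightarrow> ('i \<Rightarrow>\<^sub>0 'k) \<Rightarrow> 'c" where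
  "pm_eval sC e p = (\<Sum>x\<in>Poly_Mapping.keys p. sC (Poly_Mapping.lookup p x) (e x))"

lemma pm_eval_superset:
  assumes "vector_space sC" "finite S" "Poly_Mapping.keys p \<subseteq> S"
  shows "pm_eval sC e p = (\<Sum>x\<in>S. sC (Poly_Mapping.lookup p x) (e x))"
proof -
  interpret vector_space sC by fact
  show ?thesis unfolding pm_eval_def
    by (rule sum.mono_neutral_left) (use assms in \<open>auto simp: in_keys_iff\<close>)
qed

lemma linear_pm_eval:
  assumes "vector_space sC"
  shows "Vector_Spaces.linear pm_scale sC (pm_eval sC e)"
proof -
  interpret vector_space sC by fact
  interpret P: vector_space "pm_scale :: 'a \<Rightarrow> ('c \<Rightarrow>\<^sub>0 'a) \<Rightarrow> _" by (rule vector_space_pm)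
  show ?thesis
  proof unfold_locales
    fix p q :: "'c \<Rightarrow>\<^sub>0 'a"
    have f: "finite (Poly_Mapping.keys p \<union> Poly_Mapping.keys q)" by simp
    show "pm_eval sC e (p + q) = pm_eval sC e p + pm_eval sC e q"
      using pm_eval_superset[OF assms f, of "p + q" e] pm_eval_superset[OF assms f, of p e]
        pm_eval_superset[OF assms f, of q e] Poly_Mapping.keys_add[of p q]
      by (simp add: lookup_add scale_left_distrib sum.distrib)
  next
    fix r and p :: "'c \<Rightarrow>\<^sub>0 'a"
    have "Poly_Mapping.keys (pm_scale r p) \<subseteq> Poly_Mapping.keys p" by (auto simp: in_keys_iff lookup_pm_scale)
    then show "pm_eval sC e (pm_scale r p) = sC r (pm_eval sC e p)"
      using pm_eval_superset[OF assms, of "Poly_Mapping.keys p" "pm_scale r p" e]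
      by (simp add: pm_eval_def lookup_pm_scale scale_sum_right)
  qed
qed

lemma pm_eval_single: "vector_space sC \<Longrightarrow> pm_eval sC e (Poly_Mapping.single x 1) = e x"
  by (simp add: pm_eval_def vector_space.vector_space_assms)

lemma bilinear_opD:
  assumes "bilinear_op sX sY sZ b"
  shows "b (x + x') y = b x y + b x' y" "b x (y + y') = b x y + b x y'"
    "b (sX r x) y = sZ r (b x y)" "b x (sY r y) = sZ r (b x y)"
    "b 0 y = 0" "b x 0 = 0"
proof -
  interpret l: Vector_Spaces.linear sX sZ "\<lambda>x. b x y" for y using assms by (simp add: bilinear_op_def)
  interpret r: Vector_Spaces.linear sY sZ "b x" for x using assms by (simp add: bilinear_op_def)
  show "b (x + x') y = b x y + b x' y" by (rule l.add)
  show "b x (y + y') = b x y + b x y'" by (rule r.add)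
  show "b (sX r x) y = sZ r (b x y)" by (rule l.scale)
  show "b x (sY r y) = sZ r (b x y)" by (rule r.scale)
  show "b 0 y = 0" by (rule l.zero)
  show "b x 0 = 0" by (rule r.zero)
qed

lemma triassociative_hom_comp:
  assumes "triassociative_hom sA pA sB pB h" "triassociative_hom sB pB sC pC k"
  shows "triassociative_hom sA pA sC pC (\<lambda>x. k (h x))"
  using assms Vector_Spaces.linear_compose[of sA sB h sC k]
  by (auto simp: triassociative_hom_def o_def)

text \<open>Transport of the products along a linear map \<open>E\<close> with a linear section \<open>\<sigma>\<close>.\<close>

lemma transport_algebra:
  assumes C: "triassociative_algebra sC pC" and U: "vector_space sU"
    and E: "Vector_Spaces.linear sU sC E" and \<sigma>: "Vector_Spaces.linear sC sU \<sigma>"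
    and sec: "\<And>u. E (\<sigma> (E u)) = E u"
    and closed: "\<And>c u w. pC c (E u) (E w) \<in> range E"
  defines "pU \<equiv> \<lambda>c u w. \<sigma> (pC c (E u) (E w))"
  shows "triassociative_algebra sU pU" "triassociative_hom sU pU sC pC E"
proof -
  have sec': "E (\<sigma> (pC c (E u) (E w))) = pC c (E u) (E w)" for c u w
    using closed[of c u w] sec by auto
  have "bilinear_op sU sU sU (pU c)" for c
  proof -
    have b: "bilinear_op sC sC sC (pC c)" using C by (simp add: triassociative_algebra_def)
    then have "Vector_Spaces.linear sC sC (pC c x)" "Vector_Spaces.linear sC sC (\<lambda>x. pC c x y)" for x y
      by (auto simp: bilinear_op_def)
    then show ?thesis
      using Vector_Spaces.linear_compose[OF Vector_Spaces.linear_compose[OF E] \<sigma>]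
      unfolding bilinear_op_def pU_def o_def by blast
  qed
  moreover have "triassoc pU pU pU pU"
    using C unfolding triassociative_algebra_def triassoc_def pU_def sec'
    by (intro allI conjI) (rule arg_cong[where f = \<sigma>], blast)+
  ultimately show "triassociative_algebra sU pU" using U by (simp add: triassociative_algebra_def)
  show "triassociative_hom sU pU sC pC E"
    using E sec' by (simp add: triassociative_hom_def pU_def)
qed

lemma zero_algebra:
  assumes "vector_space sU" shows "triassociative_algebra sU (\<lambda>c x y. 0)"
proof -
  interpret vector_space sU by fact
  have "Vector_Spaces.linear sU sU (\<lambda>x. 0)" by unfold_locales auto
  then show ?thesis using assms
    by (simp add: triassociative_algebra_def bilinear_op_def triassoc_def)
qed

context
  fixes sV :: "'k::field \<Rightarrow> 'v::ab_group_add \<Rightarrow> 'v" and sA :: "'k \<Rightarrow> 'a::ab_group_add \<Rightarrow> 'a"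
    and pr :: "triop \<Rightarrow> 'a \<Rightarrow> 'a \<Rightarrow> 'a" and \<iota> :: "'v \<Rightarrow> 'a"
  assumes free: "free_triassociative_algebra sV sA pr \<iota>"
begin

private abbreviation (input) sU :: "'k \<Rightarrow> (('a list \<times> nat) \<Rightarrow>\<^sub>0 'k) \<Rightarrow> (('a list \<times> nat) \<Rightarrow>\<^sub>0 'k)"
  where "sU \<equiv> pm_scale"

private lemma basic:
  "vector_space sV" "vector_space sA" "triassociative_algebra sA pr" "Vector_Spaces.linear sV sA \<iota>"
  using free by (auto simp: free_triassociative_algebra_def triassociative_algebra_def)

private lemma UP:
  assumes "triassociative_algebra sU pU" "Vector_Spaces.linear sV sU g"
  shows "\<exists>!h. triassociative_hom sA pr sU pU h \<and> (\<forall>v. h (\<iota> v) = g v)"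
  using free assms unfolding free_triassociative_algebra_def free_extension_def by blast

private lemma inj_\<iota>: "inj \<iota>"
proof -
  interpret V: vector_space sV by (rule basic)
  interpret U: vector_space sU by (rule vector_space_pm)
  interpret VU: vector_space_pair sV sU ..
  interpret i: Vector_Spaces.linear sV sA \<iota> by (rule basic)
  have "v = 0" if "\<iota> v = 0" for v
  proof (rule ccontr)
    assume "v \<noteq> 0"
    then have "V.independent {v}" by simp
    then obtain g where g: "Vector_Spaces.linear sV sU g"
        "g v = Poly_Mapping.single undefined 1"
      using VU.linear_independent_extend[of "{v}" "\<lambda>_. Poly_Mapping.single undefined 1"] by auto
    obtain h where h: "triassociative_hom sA pr sU (\<lambda>c x y. 0) h" "\<And>v. h (\<iota> v) = g v"
      using UP[OF zero_algebra[OF vector_space_pm] g(1)] by blast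
    then have "h 0 = 0"
      using Vector_Spaces.linear.axioms(3)[of sA sU h] module_hom.zero
      by (auto simp: triassociative_hom_def)
    then show False using h(2)[of v] that g(2) Poly_Mapping.lookup_single_eq[of undefined "1 :: 'k"]
      by (metis lookup_zero zero_neq_one)
  qed
  then show ?thesis by (auto simp: inj_def) (metis eq_iff_diff_eq_0 i.diff)
qed

private definition code :: "'v tmono \<Rightarrow> 'a list \<times> nat" where
  "code m = (map \<iota> (mono_list m), to_nat (mono_shape m))"

private lemma inj_code: "inj code"
  using mono_inject inj_\<iota> by (auto simp: inj_def code_def inj_map_eq_map)

private definition E :: "('k \<Rightarrow> 'c::ab_group_add \<Rightarrow> 'c) \<Rightarrow> (triop \<Rightarrow> 'c \<Rightarrow> 'c \<Rightarrow> 'c) \<Rightarrow> ('v \<Rightarrow> 'c) \<Rightarrow>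
    (('a list \<times> nat) \<Rightarrow>\<^sub>0 'k) \<Rightarrow> 'c" where
  "E sC pC g = pm_eval sC (\<lambda>x. if x \<in> range code then mono_eval pC g (inv code x) else 0)"

private lemma E_facts:
  assumes "triassociative_algebra sC pC"
  shows "Vector_Spaces.linear sU sC (E sC pC g)"
    and "range (E sC pC g) = module.span sC (range (mono_eval pC g))"
    and "pC c (E sC pC g u) (E sC pC g w) \<in> range (E sC pC g)"
proof -
  interpret C: vector_space sC using assms by (simp add: triassociative_algebra_def)
  show lin: "Vector_Spaces.linear sU sC (E sC pC g)"
    unfolding E_def by (rule linear_pm_eval) unfold_locales
  interpret E: Vector_Spaces.linear sU sC "E sC pC g" by fact
  let ?S = "C.span (range (mono_eval pC g))"
  show r: "range (E sC pC g) = ?S"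
  proof
    show "range (E sC pC g) \<subseteq> ?S"
    proof clarify
      fix u
      have "(if x \<in> range code then mono_eval pC g (inv code x) else 0) \<in> ?S" for x
        by (simp add: C.span_base C.span_zero)
      then show "E sC pC g u \<in> ?S"
        unfolding E_def pm_eval_def by (intro C.span_sum C.span_scale)
    qed
    have "mono_eval pC g m \<in> range (E sC pC g)" for m
    proof
      show "mono_eval pC g m = E sC pC g (Poly_Mapping.single (code m) 1)"
        by (simp add: E_def pm_eval_single C.vector_space_axioms inv_f_f[OF inj_code])
    qed simp
    moreover have "C.subspace (range (E sC pC g))"
      by (rule E.subspace_image) (rule module.subspace_UNIV, unfold_locales)
    ultimately show "?S \<subseteq> range (E sC pC g)" by (intro C.span_minimal) auto
  qed
  have b: "bilinear_op sC sC sC (pC c)" using assms by (simp add: triassociative_algebra_def)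
  have "pC c x y \<in> ?S" if "x \<in> ?S" "y \<in> ?S" for x y
    using that(1)
  proof (induction rule: C.span_induct_alt)
    case base
    then show ?case by (simp add: bilinear_opD[OF b] C.span_zero)
  next
    case (step r x z)
    then obtain m where m: "x = mono_eval pC g m" by auto
    have "pC c x y \<in> ?S"
      using that(2)
    proof (induction rule: C.span_induct_alt)
      case base
      then show ?case by (simp add: bilinear_opD[OF b] C.span_zero)
    next
      case (step r' y' z')
      then obtain m' where "y' = mono_eval pC g m'" by auto
      then have "pC c x y' = mono_eval pC g (Prod c m m')" by (simp add: m)
      then have "pC c x y' \<in> ?S" using C.span_base by blast
      then show ?case using step by (simp add: bilinear_opD[OF b] C.span_add C.span_scale)
    qed
    then show ?case using step by (simp add: bilinear_opD[OF b] C.span_add C.span_scale)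
  qed
  then show "pC c (E sC pC g u) (E sC pC g w) \<in> range (E sC pC g)"
    unfolding r using r by (metis rangeI)
qed

private lemma extension_exists:
  fixes sC :: "'k \<Rightarrow> 'c::ab_group_add \<Rightarrow> 'c"
  assumes C: "triassociative_algebra sC pC" and g: "Vector_Spaces.linear sV sC g"
  shows "\<exists>h. triassociative_hom sA pr sC pC h \<and> (\<forall>v. h (\<iota> v) = g v) \<and>
    range h \<subseteq> module.span sC (range (mono_eval pC g))"
proof -
  interpret C: vector_space sC using C by (simp add: triassociative_algebra_def)
  interpret U: vector_space sU by (rule vector_space_pm)
  interpret UC: vector_space_pair sU sC ..
  let ?E = "E sC pC g"
  note E = E_facts[OF C, where g = g]
  obtain \<sigma> where \<sigma>: "Vector_Spaces.linear sC sU \<sigma>" "\<And>u. ?E (\<sigma> (?E u)) = ?E u"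
    using UC.linear_exists_right_inverse_on[OF E(1) U.subspace_UNIV] by auto
  define pU where "pU = (\<lambda>c u w. \<sigma> (pC c (?E u) (?E w)))"
  have T: "triassociative_algebra sU pU" "triassociative_hom sU pU sC pC ?E"
    using transport_algebra[OF C vector_space_pm E(1) \<sigma> E(3)] by (simp_all add: pU_def)
  obtain h where h: "triassociative_hom sA pr sU pU h" "\<And>v. h (\<iota> v) = \<sigma> (g v)"
    using UP[OF T(1) Vector_Spaces.linear_compose[OF g \<sigma>(1)]] by auto
  have "?E (\<sigma> (g v)) = g v" for v
  proof -
    have "g v = mono_eval pC g (Gen v)" by simp
    then have "g v \<in> range ?E" unfolding E(2) using C.span_base by blast
    then show ?thesis using \<sigma>(2) by auto
  qed
  then have "\<forall>v. ?E (h (\<iota> v)) = g v" by (simp add: h(2))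
  moreover have "range (\<lambda>a. ?E (h a)) \<subseteq> module.span sC (range (mono_eval pC g))"
    using E(2) by auto
  ultimately show ?thesis using triassociative_hom_comp[OF h(1) T(2)] by blast
qed

private lemma generated: "x \<in> module.span sA (range (mono_eval pr \<iota>))"
proof -
  interpret A: vector_space sA by (rule basic)
  interpret U: vector_space sU by (rule vector_space_pm)
  interpret UA: vector_space_pair sU sA ..
  obtain p where p: "triassociative_hom sA pr sA pr p" "\<And>v. p (\<iota> v) = \<iota> v"
      "range p \<subseteq> A.span (range (mono_eval pr \<iota>))"
    using extension_exists[OF basic(3,4)] by blast
  define F :: "(('a list \<times> nat) \<Rightarrow>\<^sub>0 'k) \<Rightarrow> 'a" where "F = pm_eval sA (\<lambda>x. hd (fst x))"
  have F: "Vector_Spaces.linear sU sA F" unfolding F_def by (rule linear_pm_eval) (rule basic)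
  have "F (Poly_Mapping.single ([a], 0) 1) = a" for a
    by (simp add: F_def pm_eval_single basic)
  then have surj: "surj F" by (metis surj_def)
  obtain \<kappa> where \<kappa>: "Vector_Spaces.linear sA sU \<kappa>" "\<And>a. F (\<kappa> a) = a"
    using UA.linear_surjective_right_inverse[OF F surj] by (auto simp: fun_eq_iff)
  define pU where "pU = (\<lambda>c u w. \<kappa> (pr c (F u) (F w)))"
  have T: "triassociative_algebra sU pU"
    using transport_algebra(1)[OF basic(3) vector_space_pm F \<kappa>(1)] \<kappa>(2) surj by (simp add: pU_def)
  have \<kappa>h: "triassociative_hom sA pr sU pU \<kappa>"
    using \<kappa> by (simp add: triassociative_hom_def pU_def)
  have "(\<lambda>a. \<kappa> (p a)) = \<kappa>"
    using UP[OF T Vector_Spaces.linear_compose[OF basic(4) \<kappa>(1)]]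
      triassociative_hom_comp[OF p(1) \<kappa>h] \<kappa>h p(2) by (auto simp: o_def)
  then have "p x = x" using \<kappa>(2) by metis
  then show ?thesis using p(3) by (metis rangeI subsetD)
qed

lemma free_triassociative_algebra_extension:
  fixes sC :: "'k \<Rightarrow> 'c::ab_group_add \<Rightarrow> 'c"
  assumes C: "triassociative_algebra sC pC"
  shows "free_extension sV sA pr \<iota> sC pC"
  unfolding free_extension_def
proof (intro allI impI)
  fix g assume g: "Vector_Spaces.linear sV sC g"
  interpret A: vector_space sA by (rule basic)
  interpret C: vector_space sC using C by (simp add: triassociative_algebra_def)
  interpret AC: vector_space_pair sA sC ..
  have "h = k" if "triassociative_hom sA pr sC pC h \<and> (\<forall>v. h (\<iota> v) = g v)"
    and "triassociative_hom sA pr sC pC k \<and> (\<forall>v. k (\<iota> v) = g v)" for h k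
  proof
    fix x
    have "h (mono_eval pr \<iota> m) = k (mono_eval pr \<iota> m)" for m
      by (induction m) (use that in \<open>auto simp: triassociative_hom_def\<close>)
    then show "h x = k x"
      using AC.linear_eq_on_span[of h k "range (mono_eval pr \<iota>)" x] that generated
      by (auto simp: triassociative_hom_def)
  qed
  then show "\<exists>!h. triassociative_hom sA pr sC pC h \<and> (\<forall>v. h (\<iota> v) = g v)"
    using extension_exists[OF C g] by blast
qed

end

end

theory Submission
  imports Defs
begin

text \<open>
  A planar tree with \<open>n\<close> angles (pairs of adjacent leaves) is encoded by a sequence of \<open>n\<close> levels, the
  level of an angle being the height of its vertex; only the comparisons within each subtree matter.
  Deleting an inner leaf merges two adjacent angles at the smaller level, and the product attached
  to the leaf records how the two levels compare. On pairs (level, element) the eleven identities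
  become plain associativity, and \<open>\<delta> \<circ> \<delta> = 0\<close> is the usual computation for the bar complex.

  The free algebra has a basis of words with a nonempty set of marked letters, and a product of
  basis elements is a basis element. A cochain is therefore a function on trees whose angles carry
  marked words. These decorated trees admit an acyclic matching in which a lower tree is an inner
  face of its upper partner, and every decorated tree with at least two letters is matched. The
  outer faces lower the number of letters, so for an arbitrary representation one can still
  solve \<open>\<delta>g = f\<close> recursively on the upper trees. A cocycle that vanishes on all upper trees
  vanishes on the lower ones too, by induction along the matching.
\<close>

section \<open>Trees as sequences of levels\<close>

text \<open>The obstacle is that \<open>M\<close> is arbitrary. An outer face sends the value of a
  cochain through an action of \<open>A\<close> on \<open>M\<close>, which cannot be undone, whereas
  in an inner face the value occurs with coefficient plus or minus 1. So the matching has to use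
  inner faces, and each unknown, the value of the primitive at a lower tree, is isolated in the
  equation at its upper partner; on upper trees the primitive is 0. This uses only the equations at
  upper trees. Those at lower trees come from the cocycle condition: the difference of
  \<open>f\<close> and the coboundary found is again a cocycle, and this is where the square of the
  coboundary being 0 enters. The recursion ends because every other lower face of the partner has
  smaller \<open>rank\<close>. The one decorated tree of positive degree without a partner is the
  cherry (two leaves) carrying a single letter. It has degree 1, whence the bound on
  \<open>n\<close>.\<close>

definition cmp :: "nat \<Rightarrow> nat \<Rightarrow> triop" where
  "cmp a b = (if a < b then Lft else if b < a then Rgt else Mid)"

definition merge :: "nat \<Rightarrow> nat list \<Rightarrow> nat list" where
  "merge i l = (if i = 0 then tl l else if i < length l
     then take (i - 1) l @ min (l ! (i - 1)) (l ! i) # drop (i + 1) l else butlast l)"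

text \<open>\<open>b\<close> is only a strict lower bound: a vertex may get any level above that of
  the vertex below it, and levels in different subtrees are unrelated. A tree thus has many
  sequences, and \<open>merge\<close> never has to renumber when a vertex is suppressed.\<close>

inductive levels :: "nat \<Rightarrow> ptree \<Rightarrow> nat list \<Rightarrow> bool"
  and forest_levels :: "nat \<Rightarrow> ptree list \<Rightarrow> nat list \<Rightarrow> bool" where
  Leaf: "levels b Leaf []"
| Node: "b < v \<Longrightarrow> forest_levels v ts l \<Longrightarrow> length ts \<ge> 2 \<Longrightarrow> levels b (Node ts) l"
| single: "levels v t l \<Longrightarrow> forest_levels v [t] l"
| Cons: "levels v t l \<Longrightarrow> forest_levels v ts l' \<Longrightarrow> forest_levels v (t # ts) (l @ v # l')"

inductive_cases levels_LeafE: "levels b Leaf l"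
inductive_cases levels_NodeE: "levels b (Node ts) l"
inductive_cases forest_levels_NilE: "forest_levels v [] l"
inductive_cases forest_levels_ConsE: "forest_levels v (t # ts) l"

lemma levels_shape:
  "levels b t l \<Longrightarrow> leaves t = length l + 1 \<and> wf_tree t \<and> (\<forall>x\<in>set l. b < x)"
  "forest_levels v ts l \<Longrightarrow>
     sum_list (map leaves ts) = length l + 1 \<and> (\<forall>t\<in>set ts. wf_tree t) \<and> (\<forall>x\<in>set l. v \<le> x) \<and> ts \<noteq> []"
  by (induction rule: levels_forest_levels.inducts)
    (auto dest: order.strict_trans2 intro: less_imp_le simp: order.strict_trans2)

lemma levels_eq_Nil: "levels b t [] \<Longrightarrow> t = Leaf"
proof (cases t)
  case (Node ts)
  assume "levels b t []"
  then obtain v where f: "forest_levels v ts []" "length ts \<ge> 2" using Node by (auto elim: levels_NodeE)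
  then obtain t ts' where "ts = t # ts'" "ts' \<noteq> []" by (cases ts) (auto simp: Suc_le_eq)
  then show ?thesis using f(1) by (auto elim: forest_levels_ConsE)
qed

lemma levels_mono: "levels b t l \<Longrightarrow> c \<le> b \<Longrightarrow> levels c t l"
  by (cases t) (auto elim!: levels_LeafE levels_NodeE intro: levels_forest_levels.Leaf
    levels_forest_levels.Node[OF order.strict_trans1])

lemma levels_exists: "wf_tree t \<Longrightarrow> \<exists>l. levels b t l"
proof (induction t arbitrary: b rule: wf_tree.induct)
  case 1 then show ?case using Leaf by blast
next
  case (2 ts)
  have "\<exists>l. forest_levels v us l" if "us \<noteq> []" "set us \<subseteq> set ts" for v us
    using that
  proof (induction us)
    case (Cons t us)
    then obtain l where "levels v t l" using "2.IH"[of t v] "2.prems" by auto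
    then show ?case using Cons by (cases "us = []") (auto intro: levels_forest_levels.intros)
  qed simp
  then obtain l where "forest_levels (Suc b) ts l" using 2(2) by (cases ts) fastforce+
  then show ?case using Node[of b "Suc b" ts l] "2.prems" by auto
qed

lemma append_eq_split_min:
  assumes "a @ v # c = a' @ v # c'" "\<forall>x\<in>set a. v < x" "\<forall>x\<in>set a'. v < (x::nat)"
  shows "a = a' \<and> c = c'"
  using assms
proof (induction a arbitrary: a')
  case Nil then show ?case by (cases a') auto
next
  case (Cons y a) then show ?case by (cases a') auto
qed

text \<open>The least entry is the level of the root vertex and its occurrences are the cuts between
  the subtrees, so the tree can be read back from the sequence.\<close>

lemma levels_unique:
  "levels b t l \<Longrightarrow> levels b' t' l \<Longrightarrow> t = t'"
  "forest_levels v ts l \<Longrightarrow> forest_levels v ts' l \<Longrightarrow> ts = ts'"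
proof (induction arbitrary: b' t' and ts' rule: levels_forest_levels.inducts)
  case (Leaf b)
  then show ?case using levels_eq_Nil by metis
next
  case (Node b v ts l)
  have ll: "l \<noteq> []"
    using Node.hyps levels_eq_Nil levels_forest_levels.Node by blast
  then obtain us where t': "t' = Node us" using Node.prems by (cases t') (auto elim: levels_LeafE)
  then obtain w where w: "forest_levels w us l" "length us \<ge> 2" using Node.prems by (auto elim: levels_NodeE)
  have mem: "v \<in> set l" if "forest_levels v ts l" "length ts \<ge> 2" for v ts
    using that by (cases ts) (auto elim!: forest_levels_ConsE)
  have "v = w"
    using mem[OF Node.hyps(2,3)] mem[OF w] levels_shape(2)[OF Node.hyps(2)] levels_shape(2)[OF w(1)]
    by (meson le_antisym)
  then show ?case using Node.IH w t' by auto
next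
  case (single v t l)
  note S = single
  obtain t' us where ts': "ts' = t' # us" using single.prems by (cases ts') (auto elim: forest_levels_NilE)
  have "v \<notin> set l" using levels_shape(1)[OF single.hyps] by auto
  then have "us = []" "levels v t' l" using single.prems ts' by (auto elim!: forest_levels_ConsE)
  then show ?case using single.IH ts' by auto
next
  case (Cons v t l ts l')
  note outer = Cons
  obtain t' us where ts': "ts' = t' # us" using Cons.prems by (cases ts') (auto elim: forest_levels_NilE)
  consider "levels v t' (l @ v # l')" | m m' where "l @ v # l' = m @ v # m'" "levels v t' m" "forest_levels v us m'"
    using Cons.prems(1)[unfolded ts'] by (rule forest_levels_ConsE) blast+
  then show ?case
  proof cases
    case 1
    from levels_shape(1)[OF this] show ?thesis by simp
  next
    case (2 m m')
    have "l = m \<and> l' = m'"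
      using append_eq_split_min[OF 2(1)] levels_shape(1)[OF 2(2)] levels_shape(1)[OF outer(1)]
      by blast
    then show ?thesis using outer(3)[of v t'] outer(4)[of us] 2(2) 2(3) ts' by simp
  qed
qed

text \<open>At \<open>i = length l\<close> the last angle of the block meets the lower level
  \<open>v\<close>, and the minimum swallows it: an outer face of a block is an inner merge of the
  whole sequence. \<open>merge_append_right\<close> treats the other end.\<close>

lemma merge_append_left:
  assumes "i \<le> length l" "l \<noteq> []" "\<forall>x\<in>set l. v < x"
  shows "merge i (l @ v # l') = merge i l @ v # l'"
proof (cases "i < length l")
  case True
  then show ?thesis using assms by (auto simp: merge_def nth_append)
next
  case False
  then have "i = length l" using assms by simp
  then show ?thesis using assms
    by (cases l rule: rev_cases) (auto simp: merge_def nth_append)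
qed

lemma merge_append_right:
  assumes "i \<le> length l'" "l' \<noteq> []" "\<forall>x\<in>set l'. v \<le> x"
  shows "merge (Suc (length l + i)) (l @ v # l') = l @ v # merge i l'"
proof (cases i)
  case 0
  then show ?thesis using assms by (cases l') (auto simp: merge_def nth_append)
next
  case (Suc j)
  then show ?thesis using assms by (auto simp: merge_def nth_append butlast_append numeral_3_eq_3)
qed

lemma levels_del_leaf:
  "levels b t l \<Longrightarrow> i \<le> length l \<Longrightarrow> l \<noteq> [] \<Longrightarrow> levels b (del_leaf i t) (merge i l)"
  "forest_levels v ts l \<Longrightarrow> i \<le> length l \<Longrightarrow> l \<noteq> [] \<Longrightarrow>
     forest_levels v (del_forest i ts) (merge i l)"
proof (induction arbitrary: i and i rule: levels_forest_levels.inducts)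
  case (Leaf b)
  then show ?case by simp
next
  case (Node b v ts l)
  have f: "forest_levels v (del_forest i ts) (merge i l)" using Node by simp
  show ?case
  proof (cases "\<exists>t. del_forest i ts = [t]")
    case True
    then obtain t where t: "del_forest i ts = [t]" by auto
    \<comment> \<open>The vertex is suppressed; its only remaining subtree has levels above
      \<open>v\<close>, hence above \<open>b\<close>.\<close>
    then have "levels v t (merge i l)" using f by (auto elim: forest_levels_ConsE forest_levels_NilE)
    then show ?thesis using t levels_mono Node.hyps(1) by (simp add: less_imp_le)
  next
    case False
    moreover have "del_forest i ts \<noteq> []" using f levels_shape(2) by blast
    ultimately have "suppress (del_forest i ts) = Node (del_forest i ts)" "length (del_forest i ts) \<ge> 2"
      by (cases "del_forest i ts" rule: suppress.cases; auto)+
    then show ?thesis using f Node.hyps(1) levels_forest_levels.Node by simp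
  qed
next
  case (single v t l)
  then have "t \<noteq> Leaf" by (auto elim: levels_LeafE)
  moreover have "i < leaves t" using single.prems levels_shape(1)[OF single.hyps] by simp
  ultimately show ?case using single by (simp add: levels_forest_levels.single)
next
  case (Cons v t l ts l')
  note t = levels_shape(1)[OF Cons.hyps(1)] and ts = levels_shape(2)[OF Cons.hyps(2)]
  show ?case
  proof (cases "i \<le> length l")
    case True
    show ?thesis
    proof (cases "t = Leaf")
      case True': True
      then show ?thesis using True Cons.hyps t by (auto simp: merge_def)
    next
      case False
      then have "l \<noteq> []" using Cons.hyps(1) levels_eq_Nil by blast
      then show ?thesis
        using Cons False True t merge_append_left[of i l v l'] levels_forest_levels.Cons by auto
    qed
  next
    case False
    then obtain j where j: "i = Suc (length l + j)" by (metis add_Suc_right less_imp_Suc_add not_le)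
    then have jl: "j \<le> length l'" using Cons.prems by simp
    show ?thesis
    proof (cases "l' = []")
      case True
      \<comment> \<open>The deleted leaf is the last edge of the vertex, and the angle
        \<open>v\<close> disappears with it through \<open>butlast\<close>.\<close>
      have "ts = [Leaf]" using Cons.hyps(2) True levels_eq_Nil
        by (cases ts) (auto elim!: forest_levels_ConsE elim: forest_levels_NilE)
      then show ?thesis using j jl True t Cons.hyps(1)
        by (auto simp: merge_def butlast_append intro: levels_forest_levels.single)
    next
      case False
      then show ?thesis
        using Cons jl j t ts merge_append_right[of j l' v l] levels_forest_levels.Cons by auto
    qed
  qed
qed

text \<open>A sentinel below all levels at both ends accounts for the outermost leaves.\<close>

lemma levels_leaf_op:
  "levels b t l \<Longrightarrow> t \<noteq> Leaf \<Longrightarrow> i \<le> length l \<Longrightarrow>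
     leaf_op i t = cmp ((b # l @ [b]) ! i) ((l @ [b]) ! i)"
  "forest_levels v ts l \<Longrightarrow> b < v \<Longrightarrow> i \<le> length l \<Longrightarrow> (fl \<Longrightarrow> ts \<noteq> [Leaf]) \<Longrightarrow>
     leaf_op_forest fl i ts = cmp (((if fl then b else v) # l @ [b]) ! i) ((l @ [b]) ! i)"
proof (induction arbitrary: i and i b fl rule: levels_forest_levels.inducts)
  case (Leaf b)
  then show ?case by simp
next
  case (Node b v ts l)
  have "leaf_op_forest True i ts = cmp (((if True then b else v) # l @ [b]) ! i) ((l @ [b]) ! i)"
    by (rule Node.IH) (use Node in auto)
  then show ?case by simp
next
  case (single v t l)
  show ?case
  proof (cases "t = Leaf")
    case True
    then show ?thesis using single by (auto elim!: levels_LeafE simp: cmp_def)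
  next
    case False
    then have ne: "l \<noteq> []" using single.hyps(1) levels_eq_Nil by blast
    \<comment> \<open>The sentinel here is \<open>v\<close>; all entries of \<open>l\<close> exceed
      both \<open>v\<close> and \<open>b\<close>, so the comparisons at the ends agree.\<close>
    have "leaf_op i t = cmp ((v # l @ [v]) ! i) ((l @ [v]) ! i)"
      by (rule single.IH) (use single False in auto)
    moreover have "v < l ! (i - 1)"
    proof -
      have "i - 1 < length l" using single.prems ne by (cases l) auto
      then show ?thesis using levels_shape(1)[OF single.hyps] by simp
    qed
    ultimately show ?thesis using False single.prems ne levels_shape(1)[OF single.hyps, THEN conjunct1]
      by (cases i) (auto simp: cmp_def nth_append)
  qed
next
  case (Cons v t l ts l')
  note t = levels_shape(1)[OF Cons.hyps(1)] and ts = levels_shape(2)[OF Cons.hyps(2)]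
  show ?case
  proof (cases "i \<le> length l")
    case True
    show ?thesis
    proof (cases "t = Leaf")
      case True': True
      then show ?thesis using True Cons ts by (auto elim!: levels_LeafE simp: cmp_def)
    next
      case False
      then have ne: "l \<noteq> []" using Cons.hyps(1) levels_eq_Nil by blast
      have op: "leaf_op i t = cmp ((v # l @ [v]) ! i) ((l @ [v]) ! i)"
        by (rule Cons.IH) (use True False in auto)
      have "i - 1 < length l" using True ne by (cases l) auto
      then have "v < l ! (i - 1)" using t by simp
      then show ?thesis using op False True Cons.prems ne t[THEN conjunct1]
        by (cases i) (auto simp: cmp_def nth_append)
    qed
  next
    case False
    then obtain j where j: "i = Suc (length l + j)" by (metis add_Suc_right less_imp_Suc_add not_le)
    \<comment> \<open>The angle \<open>v\<close> just cut off takes over as left neighbour of the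
      first remaining leaf; the flag \<open>False\<close> stands for this.\<close>
    have "leaf_op_forest False j ts = cmp (((if False then b else v) # l' @ [b]) ! j) ((l' @ [b]) ! j)"
      by (rule Cons.IH) (use Cons.prems j in auto)
    then show ?thesis using j t by (simp add: nth_append nth_Cons' split: if_splits)
  qed
qed

text \<open>The inductive definition peels off subtrees from the left, while \<open>last_op\<close>
  looks at the rightmost one.\<close>

lemma forest_levels_snoc:
  "forest_levels v ts l \<Longrightarrow>
     (\<exists>t. ts = [t] \<and> levels v t l) \<or>
     (\<exists>ts' t l1 l2. ts = ts' @ [t] \<and> l = l1 @ v # l2 \<and> forest_levels v ts' l1 \<and> levels v t l2)"
proof (induction ts arbitrary: l)
  case Nil
  then show ?case by (auto elim: forest_levels_NilE)
next
  case (Cons t ts)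
  from Cons.prems show ?case
  proof (rule forest_levels_ConsE)
    fix m m'
    assume l: "l = m @ v # m'" and m: "levels v t m" and f: "forest_levels v ts m'"
    from Cons.IH[OF f] consider t' where "ts = [t']" "levels v t' m'"
      | ts' t' l1 l2 where "ts = ts' @ [t']" "m' = l1 @ v # l2" "forest_levels v ts' l1" "levels v t' l2"
      by blast
    then show ?case
    proof cases
      case (1 t')
      then have "t # ts = [t] @ [t']" by simp
      then show ?thesis using l m 1 levels_forest_levels.single by blast
    next
      case (2 ts' t' l1 l2)
      then have "t # ts = (t # ts') @ [t']" "l = (m @ v # l1) @ v # l2" using l by auto
      then show ?thesis using levels_forest_levels.Cons[OF m 2(3)] 2(4) by blast
    qed
  qed auto
qed

lemma Min_eq_lower_bound: "finite S \<Longrightarrow> v \<in> S \<Longrightarrow> \<forall>x\<in>S. v \<le> x \<Longrightarrow> Min S = (v::nat)"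
  by (rule Min_eqI) auto

text \<open>Let \<open>v\<close> be the level of the root vertex. If the first subtree is
  nontrivial, \<open>hd l\<close> lies above \<open>v\<close>, the minimum of the rest. If it is a
  leaf, \<open>hd l = v\<close>, and \<open>v\<close> recurs in the rest exactly when the root has
  more than two edges.\<close>

lemma levels_first_op:
  assumes "levels b t l" "length l \<ge> 2"
  shows "first_op t = cmp (hd l) (Min (set (tl l)))"
proof -
  obtain ts where t: "t = Node ts" using assms by (cases t) (auto elim: levels_LeafE)
  then obtain v where v: "forest_levels v ts l" "length ts \<ge> 2" using assms by (auto elim: levels_NodeE)
  then obtain s ss where ss: "ts = s # ss" "ss \<noteq> []" by (cases ts) (auto simp: Suc_le_eq)
  then obtain l1 l2 where l: "l = l1 @ v # l2" "levels v s l1" "forest_levels v ss l2"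
    using v(1) by (auto elim!: forest_levels_ConsE)
  note s = levels_shape(1)[OF l(2)] and ss' = levels_shape(2)[OF l(3)]
  show ?thesis
  proof (cases l1)
    case Nil
    then have "s = Leaf" using l(2) levels_eq_Nil by blast
    show ?thesis
    proof (cases "length ss = 1")
      case True
      then obtain u where u: "ss = [u]" by (cases ss) auto
      then have "\<forall>x\<in>set l2. v < x"
        using l(3) levels_shape(1) by (auto elim!: forest_levels_ConsE elim: forest_levels_NilE)
      moreover have "l2 \<noteq> []" using l assms(2) Nil by auto
      ultimately show ?thesis
        using Nil l t ss u \<open>s = Leaf\<close> by (auto simp: cmp_def tree_degree_def)
    next
      case False
      then obtain u us where u: "ss = u # us" "us \<noteq> []" using ss by (cases ss) auto
      then have "v \<in> set l2" using l(3) by (auto elim!: forest_levels_ConsE)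
      then have "Min (set l2) = v" using ss' Min_eq_lower_bound by auto
      then show ?thesis using Nil l t ss u \<open>s = Leaf\<close> by (auto simp: cmp_def tree_degree_def)
    qed
  next
    case (Cons x l1')
    then have "Min (set (tl l)) = v" using l s ss' by (intro Min_eq_lower_bound) auto
    then show ?thesis using Cons l t ss s by (auto simp: cmp_def tree_degree_def)
  qed
qed

lemma levels_last_op:
  assumes "levels b t l" "length l \<ge> 2"
  shows "last_op t = cmp (Min (set (butlast l))) (last l)"
proof -
  obtain ts where t: "t = Node ts" using assms by (cases t) (auto elim: levels_LeafE)
  then obtain v where v: "forest_levels v ts l" "length ts \<ge> 2" using assms by (auto elim: levels_NodeE)
  then obtain s ss l1 l2 where ss: "ts = ss @ [s]"
    and l: "l = l1 @ v # l2" "forest_levels v ss l1" "levels v s l2"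
    using forest_levels_snoc[OF v(1)] by auto
  note s = levels_shape(1)[OF l(3)] and ss' = levels_shape(2)[OF l(2)]
  show ?thesis
  proof (cases "l2 = []")
    case True
    then have "s = Leaf" using l(3) levels_eq_Nil by blast
    show ?thesis
    proof (cases "length ss = 1")
      case ss1: True
      then obtain u where u: "ss = [u]" by (cases ss) auto
      then have "\<forall>x\<in>set l1. v < x"
        using l(2) levels_shape(1) by (auto elim!: forest_levels_ConsE elim: forest_levels_NilE)
      moreover have "l1 \<noteq> []" using l assms(2) True by auto
      ultimately have "v < Min (set l1)" by simp
      then show ?thesis
        using True l t ss u \<open>s = Leaf\<close> by (auto simp: cmp_def tree_degree_def butlast_append)
    next
      case False
      then obtain u us where u: "ss = u # us" "us \<noteq> []" using ss' by (cases ss) auto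
      then have "v \<in> set l1" using l(2) by (auto elim!: forest_levels_ConsE)
      then have "Min (set l1) = v" using ss' Min_eq_lower_bound by auto
      then show ?thesis using True l t ss u \<open>s = Leaf\<close> by (auto simp: cmp_def tree_degree_def butlast_append)
    qed
  next
    case False
    then have "Min (set (butlast l)) = v" using l s ss'
      by (intro Min_eq_lower_bound) (auto simp: butlast_append dest: in_set_butlastD intro: less_imp_le)
    then show ?thesis using False l t ss s by (auto simp: cmp_def tree_degree_def)
  qed
qed

lemma levels_trees: "levels b t l \<Longrightarrow> t \<in> trees (length l)"
  using levels_shape(1) by (auto simp: trees_def)

lemma trees_levels: "t \<in> trees n \<Longrightarrow> \<exists>l. levels 0 t l \<and> length l = n"
  using levels_exists[of t 0] levels_shape(1)[of 0 t] by (auto simp: trees_def)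

lemma levels_tree_op:
  assumes "levels b t l" "length l \<ge> 2"
  shows "tree_op 0 t = cmp (hd l) (Min (set (tl l)))"
    and "tree_op (length l) t = cmp (Min (set (butlast l))) (last l)"
    and "0 < i \<Longrightarrow> i < length l \<Longrightarrow> tree_op i t = cmp (l ! (i - 1)) (l ! i)"
proof -
  have d: "tree_degree t = length l" "t \<noteq> Leaf"
    using levels_shape(1)[OF assms(1)] assms(2) by (auto simp: tree_degree_def)
  show "tree_op 0 t = cmp (hd l) (Min (set (tl l)))"
    using levels_first_op[OF assms] by (simp add: tree_op_def)
  show "tree_op (length l) t = cmp (Min (set (butlast l))) (last l)"
    using levels_last_op[OF assms] d assms(2) by (auto simp: tree_op_def)
  show "tree_op i t = cmp (l ! (i - 1)) (l ! i)" if "0 < i" "i < length l"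
    using levels_leaf_op(1)[OF assms(1) d(2), of i] d that by (auto simp: tree_op_def nth_append nth_Cons')
qed

lemma trees_del_leaf: "t \<in> trees (n + 1) \<Longrightarrow> i \<le> n + 1 \<Longrightarrow> del_leaf i t \<in> trees n"
proof -
  assume "t \<in> trees (n + 1)" "i \<le> n + 1"
  then obtain l where l: "levels 0 t l" "length l = n + 1" using trees_levels by blast
  then have "levels 0 (del_leaf i t) (merge i l)" using levels_del_leaf(1) \<open>i \<le> n + 1\<close> by fastforce
  moreover have "length (merge i l) = n" using l \<open>i \<le> n + 1\<close> by (auto simp: merge_def)
  ultimately show ?thesis using levels_trees by blast
qed

section \<open>The cochain complex\<close>

context
  fixes mul :: "'z \<Rightarrow> 'z \<Rightarrow> 'z" and la :: "'z \<Rightarrow> 'w \<Rightarrow> 'w" and ra :: "'w \<Rightarrow> 'z \<Rightarrow> 'w"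
begin

definition bar_face :: "nat \<Rightarrow> nat \<Rightarrow> 'z list \<Rightarrow> 'z list" where
  "bar_face n i z = (if i = 0 then tl z
     else if i \<le> n then take (i - 1) z @ mul (z ! (i - 1)) (z ! i) # drop (i + 1) z else butlast z)"

definition bar_act :: "nat \<Rightarrow> nat \<Rightarrow> 'z list \<Rightarrow> 'w \<Rightarrow> 'w" where
  "bar_act n i z w = (if i = 0 then la (hd z) w else if i \<le> n then w else ra w (last z))"

definition bar_coface :: "nat \<Rightarrow> nat \<Rightarrow> ('z list \<Rightarrow> 'w) \<Rightarrow> 'z list \<Rightarrow> 'w" where
  "bar_coface n i F z = bar_act n i z (F (bar_face n i z))"

lemma list_split2:
  assumes "0 < i" "i < length z"
  obtains xs x y ys where "z = xs @ x # y # ys" "length xs = i - 1"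
proof
  have "drop (i - 1) z = z ! (i - 1) # z ! i # drop (i + 1) z"
    using assms Cons_nth_drop_Suc[of "i - 1" z] Cons_nth_drop_Suc[of i z] by simp
  then show "z = take (i - 1) z @ z ! (i - 1) # z ! i # drop (i + 1) z"
    by (metis append_take_drop_id)
  show "length (take (i - 1) z) = i - 1" using assms by simp
qed

lemma bar_face_merge:
  "length xs + 1 \<le> n \<Longrightarrow> i = length xs + 1 \<Longrightarrow> bar_face n i (xs @ x # y # ys) = xs @ mul x y # ys"
  by (simp add: bar_face_def nth_append)

text \<open>Stated for bare maps, because levels carry no linear structure. Cases 1, 3, 4 and 7 use
  the laws \<open>la\<close>, \<open>lra\<close>, \<open>mul\<close> and \<open>ra\<close>, in this
  order; in cases 2, 5 and 6 the two faces act at disjoint places.\<close>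

lemma bar_coface_coface:
  assumes mul: "\<And>x y z. mul (mul x y) z = mul x (mul y z)"
    and la: "\<And>x y w. la (mul x y) w = la x (la y w)"
    and lra: "\<And>x y w. ra (la x w) y = la x (ra w y)"
    and ra: "\<And>x y w. ra (ra w x) y = ra w (mul x y)"
    and len: "length z = n + 2" and ij: "i < j" "j \<le> n + 2"
  shows "bar_coface (n + 1) j (bar_coface n i F) z = bar_coface (n + 1) i (bar_coface n (j - 1) F) z"
proof -
  consider "i = 0" "j = 1" | "i = 0" "2 \<le> j" "j \<le> n + 1" | "i = 0" "j = n + 2" "j \<noteq> 1"
    | "0 < i" "j = i + 1" "j \<le> n + 1" | "0 < i" "i + 2 \<le> j" "j \<le> n + 1"
    | "0 < i" "i \<le> n" "j = n + 2" | "i = n + 1" "j = n + 2" "0 < i"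
    using ij by atomize_elim presburger
  then show ?thesis
  proof cases
    case 1
    obtain x y ys where "z = x # y # ys" using len by (cases z; cases "tl z") auto
    then show ?thesis using 1 len la by (auto simp: bar_coface_def bar_face_def bar_act_def Let_def)
  next
    case 2
    obtain xs x y ys where z: "z = xs @ x # y # ys" "length xs = j - 1"
      by (rule list_split2[of j z]) (use len 2 in auto)
    moreover obtain u us where "xs = u # us" using z 2 by (cases xs) auto
    ultimately have z: "z = u # us @ x # y # ys" "j = length us + 2" using 2 by auto
    show ?thesis using 2 z len
      bar_face_merge[of "u # us" "n + 1" j x y ys] bar_face_merge[of us n "j - 1" x y ys]
      by (simp add: bar_coface_def bar_face_def[of _ 0] bar_act_def)
  next
    case 3
    obtain x ys y where "z = x # ys @ [y]" using len
      by (cases z; cases "tl z" rule: rev_cases) auto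
    then show ?thesis using 3 len lra
      by (auto simp: bar_coface_def bar_face_def bar_act_def Let_def butlast_append)
  next
    case 4
    obtain xs x y ys where z: "z = xs @ x # y # ys" "length xs = i - 1"
      by (rule list_split2[of i z]) (use len 4 in auto)
    moreover obtain w ws where "ys = w # ws" using z 4 len by (cases ys) auto
    ultimately have z: "z = xs @ x # y # w # ws" "i = length xs + 1" using 4 by auto
    have "bar_face (n + 1) j z = xs @ x # mul y w # ws" "bar_face (n + 1) i z = xs @ mul x y # w # ws"
      using bar_face_merge[of "xs @ [x]" "n + 1" j y w ws] bar_face_merge[of xs "n + 1" i x y "w # ws"] 4 z
      by auto
    then show ?thesis using 4 z len mul
      bar_face_merge[of xs n i x "mul y w" ws] bar_face_merge[of xs n i "mul x y" w ws]
      by (simp add: bar_coface_def bar_act_def)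
  next
    case 5
    obtain xs x y ys where z: "z = xs @ x # y # ys" "length xs = i - 1"
      by (rule list_split2[of i z]) (use len 5 in auto)
    have "0 < j - i - 1" "j - i - 1 < length ys" using 5 len z by auto
    then obtain us u v vs where ys: "ys = us @ u # v # vs" "length us = j - i - 1 - 1"
      by (rule list_split2)
    have z: "z = xs @ x # y # us @ u # v # vs" "i = length xs + 1" "j = length us + i + 2"
      using z ys 5 by auto
    have "bar_face (n + 1) j z = xs @ x # y # us @ mul u v # vs"
      "bar_face (n + 1) i z = xs @ mul x y # us @ u # v # vs"
      using bar_face_merge[of "xs @ x # y # us" "n + 1" j u v vs]
        bar_face_merge[of xs "n + 1" i x y "us @ u # v # vs"] 5 z
      by auto
    moreover have "bar_face n i (xs @ x # y # us @ mul u v # vs) = xs @ mul x y # us @ mul u v # vs"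
      "bar_face n (j - 1) (xs @ mul x y # us @ u # v # vs) = xs @ mul x y # us @ mul u v # vs"
      using bar_face_merge[of "xs @ mul x y # us" n "j - 1" u v vs]
        bar_face_merge[of xs n i x y "us @ mul u v # vs"] 5 z
      by auto
    moreover have "j - 1 \<le> n" using 5 by simp
    ultimately show ?thesis using 5 by (simp add: bar_coface_def bar_act_def)
  next
    case 6
    obtain xs x y ys where z: "z = xs @ x # y # ys" "length xs = i - 1"
      by (rule list_split2[of i z]) (use len 6 in auto)
    moreover obtain w ws where "ys = ws @ [w]" using z 6 len by (cases ys rule: rev_cases) auto
    ultimately have z: "z = xs @ x # y # ws @ [w]" "i = length xs + 1" using 6 by auto
    show ?thesis using 6 z len
      bar_face_merge[of xs "n + 1" i x y "ws @ [w]"] bar_face_merge[of xs n i x y ws]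
      by (simp add: bar_coface_def bar_face_def[of _ "Suc (Suc n)"] bar_face_def[of _ "Suc n"]
          bar_act_def butlast_append)
  next
    case 7
    obtain xs x y ys where z: "z = xs @ x # y # ys" "length xs = i - 1"
      by (rule list_split2[of i z]) (use len 7 in auto)
    then have z: "z = xs @ [x, y]" "i = length xs + 1" using 7 len by auto
    show ?thesis using 7 z len ra bar_face_merge[of xs "n + 1" i x y "[]"]
      by (simp add: bar_coface_def bar_face_def[of _ "Suc (Suc n)"] bar_face_def[of n "Suc n"]
          bar_act_def butlast_append)
  qed
qed

end

text \<open>Three numbers have 13 weak orderings. The three with \<open>b\<close> strictly smallest
  all give the third identity, and the other ten give one identity each, so the eleven identities
  are exactly these cases.\<close>

lemma triassoc_cmp:
  assumes "triassoc p q r s"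
  shows "q (cmp (min a b) c) (p (cmp a b) x y) z = s (cmp a (min b c)) x (r (cmp b c) y z)"
  using assms[unfolded triassoc_def, rule_format, of x y z]
  by (cases a b rule: linorder_cases; cases b c rule: linorder_cases; cases a c rule: linorder_cases)
    (simp_all add: cmp_def min_def)

section \<open>Transport of the bar complex to trees along levels\<close>

definition tree_of_levels :: "nat list \<Rightarrow> ptree" where
  "tree_of_levels l = (THE t. levels 0 t l)"

lemma tree_of_levels: "levels 0 t l \<Longrightarrow> tree_of_levels l = t"
  unfolding tree_of_levels_def using levels_unique(1) by blast

definition graded :: "(triop \<Rightarrow> 'x \<Rightarrow> 'y \<Rightarrow> 'z) \<Rightarrow> nat \<times> 'x \<Rightarrow> nat \<times> 'y \<Rightarrow> nat \<times> 'z" where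
  "graded p x y = (min (fst x) (fst y), p (cmp (fst x) (fst y)) (snd x) (snd y))"

lemma graded_assoc:
  assumes "triassoc p q r s"
  shows "graded q (graded p x y) z = graded s x (graded r y z)"
  using triassoc_cmp[OF assms, of "fst x" "fst y" "fst z"] by (simp add: graded_def min.assoc)

lemma Min_insert_insert:
  "finite S \<Longrightarrow> Min (insert a (insert b S)) = Min (insert (min a b) (S :: nat set))"
  by (cases "S = {}") (simp_all add: min.assoc)

text \<open>The value in \<open>M\<close> stands for the whole block of arguments, so it gets the
  level of the root vertex; comparing a neighbour with this level yields the products of the outer
  faces.\<close>

definition graded_cochain :: "(ptree \<Rightarrow> 'a list \<Rightarrow> 'm) \<Rightarrow> (nat \<times> 'a) list \<Rightarrow> nat \<times> 'm" where
  "graded_cochain f z = (Min (set (map fst z)), f (tree_of_levels (map fst z)) (map snd z))"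

lemma bilinear_op_linear:
  assumes "bilinear_op sX sY sZ b"
  shows "Vector_Spaces.linear sY sZ (b x)" "Vector_Spaces.linear sX sZ (\<lambda>x. b x y)"
  using assms by (auto simp: bilinear_op_def)

locale triassociative_module =
  fixes sA :: "'k::field \<Rightarrow> 'a::ab_group_add \<Rightarrow> 'a" and pr :: "triop \<Rightarrow> 'a \<Rightarrow> 'a \<Rightarrow> 'a"
    and sM :: "'k \<Rightarrow> 'm::ab_group_add \<Rightarrow> 'm"
    and lact :: "triop \<Rightarrow> 'a \<Rightarrow> 'm \<Rightarrow> 'm" and ract :: "triop \<Rightarrow> 'm \<Rightarrow> 'a \<Rightarrow> 'm"
  assumes algebra: "triassociative_algebra sA pr"
    and representation: "triassociative_representation sA pr sM lact ract"
begin

sublocale A: vector_space sA using algebra by (simp add: triassociative_algebra_def)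
sublocale M: vector_space sM using representation by (simp add: triassociative_representation_def)

lemma bilinear: "bilinear_op sA sA sA (pr c)" "bilinear_op sA sM sM (lact c)" "bilinear_op sM sA sM (ract c)"
  using algebra representation
  by (auto simp: triassociative_algebra_def triassociative_representation_def)

abbreviation "face \<equiv> bar_face (graded pr)"
abbreviation "graded_coface \<equiv> bar_coface (graded pr) (graded lact) (graded ract)"

lemma levels_face:
  assumes "levels 0 t (map fst z)" "length z = n + 1" "i \<le> n + 1"
  shows "levels 0 (del_leaf i t) (map fst (face n i z))" "length (face n i z) = n"
proof -
  have "map fst (face n i z) = merge i (map fst z)"
    using assms by (auto simp: bar_face_def merge_def map_tl map_butlast take_map drop_map graded_def)
  then show "levels 0 (del_leaf i t) (map fst (face n i z))"
    using levels_del_leaf(1)[OF assms(1), of i] assms(2,3) by (cases z) auto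
  show "length (face n i z) = n" using assms by (auto simp: bar_face_def)
qed

text \<open>In the first component all cofaces preserve the minimum of the levels; in the second,
  \<open>levels_tree_op\<close> identifies the products. For \<open>n = 0\<close> the value would
  have the minimum of the empty set as its level.\<close>

lemma graded_coface_cochain:
  assumes t: "levels 0 t (map fst z)" and len: "length z = n + 1" "n \<ge> 1" and i: "i \<le> n + 1"
  shows "graded_coface n i (graded_cochain f) z = graded_cochain (coface pr lact ract n i f) z"
proof -
  note L = levels_face[OF t len(1) i]
  note ops = levels_tree_op[OF t]
  have Min: "Min (set (map fst z)) = fst (graded_coface n i (graded_cochain f) z)"
  proof -
    consider "i = 0" | "0 < i" "i \<le> n" | "i = n + 1" using i by linarith
    then show ?thesis
    proof cases
      case 1
      obtain x y ys where "z = x # y # ys" using len by (cases z; cases "tl z") auto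
      then show ?thesis using 1
        by (simp add: bar_coface_def bar_act_def bar_face_def graded_cochain_def graded_def)
    next
      case 2
      obtain xs x y ys where z: "z = xs @ x # y # ys" "length xs = i - 1"
        by (rule list_split2[of i z]) (use len 2 in auto)
      have fz: "face n i z = xs @ graded pr x y # ys"
        unfolding z(1) by (rule bar_face_merge) (use z(2) 2 in auto)
      have "set (map fst z) = insert (fst x) (insert (fst y) (fst ` set (xs @ ys)))"
        unfolding z(1) by auto
      moreover have "set (map fst (face n i z)) = insert (min (fst x) (fst y)) (fst ` set (xs @ ys))"
        unfolding fz by (auto simp: graded_def)
      ultimately show ?thesis using 2 Min_insert_insert[of "fst ` set (xs @ ys)" "fst x" "fst y"]
        by (simp add: bar_coface_def bar_act_def graded_cochain_def del: set_append)
    next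
      case 3
      obtain xs y where "z = xs @ [y]" "xs \<noteq> []" using len
        by (cases z rule: rev_cases) (auto simp: Suc_le_eq)
      then show ?thesis using 3
        by (simp add: bar_coface_def bar_act_def bar_face_def graded_cochain_def graded_def min.commute)
    qed
  qed
  have z: "z \<noteq> []" "tl z \<noteq> []" "butlast z \<noteq> []" using len by (auto simp: length_0_conv[symmetric] simp del: length_0_conv)
  have "coface pr lact ract n i f t (map snd z) = snd (graded_coface n i (graded_cochain f) z)"
  proof -
    consider "i = 0" | "0 < i" "i \<le> n" | "i = n + 1" using i by linarith
    then show ?thesis
      by cases
        (use z len ops(1,2) ops(3)[of i] tree_of_levels[OF L(1)] in
          \<open>auto simp: coface_def bar_coface_def bar_act_def bar_face_def graded_cochain_def graded_def map_tl
            map_butlast take_map drop_map hd_map last_map\<close>)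
  qed
  then show ?thesis using Min tree_of_levels[OF t] by (simp add: graded_cochain_def prod_eq_iff)
qed

text \<open>Zipping \<open>as\<close> with any level sequence of \<open>t\<close> turns this into
  the identity of the bar complex; \<open>n \<ge> 1\<close> keeps all intermediate lists
  nonempty.\<close>

lemma coface_coface:
  assumes "n \<ge> 1" "t \<in> trees (n + 2)" "length as = n + 2" "i < j" "j \<le> n + 2"
  shows "coface pr lact ract (n + 1) j (coface pr lact ract n i f) t as =
    coface pr lact ract (n + 1) i (coface pr lact ract n (j - 1) f) t as"
proof -
  obtain l where l: "levels 0 t l" "length l = n + 2" using trees_levels assms(2) by blast
  define z where "z = zip l as"
  have z: "levels 0 t (map fst z)" "map snd z = as" "length z = n + 1 + 1"
    using l assms by (auto simp: z_def)
  have *: "graded_coface (n + 1) j' (graded_coface n i' (graded_cochain f)) z =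
      graded_cochain (coface pr lact ract (n + 1) j' (coface pr lact ract n i' f)) z"
    if "i' \<le> n + 1" "j' \<le> n + 2" for i' j'
  proof -
    have "graded_coface (n + 1) j' (graded_coface n i' (graded_cochain f)) z = graded_coface (n + 1) j' (graded_cochain (coface pr lact ract n i' f)) z"
      using graded_coface_cochain[OF levels_face[OF z(1,3), of j']] that assms(1)
      by (simp add: bar_coface_def[of _ _ _ "Suc n"])
    then show ?thesis using graded_coface_cochain[OF z(1,3)] that by simp
  qed
  have tri: "triassoc pr pr pr pr" "triassoc ract ract pr ract" "triassoc lact ract ract lact"
      "triassoc pr lact lact lact"
    using algebra representation
    by (auto simp: triassociative_algebra_def triassociative_representation_def)
  have "graded_coface (n + 1) j (graded_coface n i (graded_cochain f)) z = graded_coface (n + 1) i (graded_coface n (j - 1) (graded_cochain f)) z"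
    by (rule bar_coface_coface) (use assms z tri[THEN graded_assoc] in auto)
  then show ?thesis
    using *[of i j] *[of "j - 1" i] assms z(2) tree_of_levels[OF z(1)] by (simp add: graded_cochain_def)
qed

lemma sM_minus_one: "sM ((- 1) ^ i) x = (if even i then x else - x)"
  by (simp add: M.scale_minus_left uminus_power_if)

lemma sum_alternating_faces:
  assumes "\<And>i j. i < j \<Longrightarrow> j \<le> n + 1 \<Longrightarrow> a i j = a (j - 1) i"
  shows "(\<Sum>j\<le>n + 1. \<Sum>i\<le>n. sM ((- 1) ^ (i + j)) (a i j)) = 0"
proof -
  let ?P = "{..n} \<times> {..n + 1}"
  let ?f = "\<lambda>(i, j). sM ((- 1) ^ (i + j)) (a i j)"
  have "(\<Sum>p\<in>{p\<in>?P. fst p < snd p}. ?f p) = (\<Sum>p\<in>{p\<in>?P. snd p \<le> fst p}. - ?f p)"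
    by (rule sum.reindex_bij_witness[of _ "\<lambda>(i, j). (j, i + 1)" "\<lambda>(i, j). (j - 1, i)"])
      (auto simp: assms sM_minus_one split: if_splits)
  moreover have "(\<Sum>j\<le>n + 1. \<Sum>i\<le>n. sM ((- 1) ^ (i + j)) (a i j)) = (\<Sum>p\<in>?P. ?f p)"
    by (subst sum.swap) (simp add: sum.cartesian_product del: sum.atMost_Suc)
  moreover have "(\<Sum>p\<in>?P. ?f p) =
      (\<Sum>p\<in>{p\<in>?P. fst p < snd p}. ?f p) + (\<Sum>p\<in>{p\<in>?P. snd p \<le> fst p}. ?f p)"
    by (subst sum.union_disjoint[symmetric]) (auto intro: sum.cong)
  ultimately show ?thesis by (simp add: sum_negf)
qed

lemma lact_simps: "lact c x (sM r y) = sM r (lact c x y)" "lact c x (\<Sum>i\<in>I. g i) = (\<Sum>i\<in>I. lact c x (g i))"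
  and ract_simps: "ract c (sM r y) x = sM r (ract c y x)" "ract c (\<Sum>i\<in>I. g i) x = (\<Sum>i\<in>I. ract c (g i) x)"
  using bilinear_opD[OF bilinear(2)] bilinear_opD[OF bilinear(3)]
  by (auto intro: sum_comp_morphism[symmetric, unfolded o_def])

lemma coface_sum:
  assumes "\<And>bs. length bs = n \<Longrightarrow> F (del_leaf j t) bs = (\<Sum>i\<in>I. sM (c i) (G i (del_leaf j t) bs))"
    and "length as = n + 1" "j \<le> n + 1"
  shows "coface pr lact ract n j F t as = (\<Sum>i\<in>I. sM (c i) (coface pr lact ract n j (G i) t as))"
  using assms by (cases "j = n + 1") (auto simp: coface_def lact_simps ract_simps)

lemma coboundary_coboundary:
  assumes "n \<ge> 1"
  shows "coboundary pr sM lact ract (n + 1) (coboundary pr sM lact ract n f) = (\<lambda>t as. 0)"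
proof (intro ext)
  fix t as
  show "coboundary pr sM lact ract (n + 1) (coboundary pr sM lact ract n f) t as = 0"
  proof (cases "t \<in> trees (n + 2) \<and> length as = n + 2")
    case True
    have "coboundary pr sM lact ract (n + 1) (coboundary pr sM lact ract n f) t as =
      (\<Sum>j\<le>n + 1 + 1. sM ((- 1) ^ j) (coface pr lact ract (n + 1) j (coboundary pr sM lact ract n f) t as))"
      using True by (simp add: coboundary_def[of _ _ _ _ "Suc n"] del: sum.atMost_Suc)
    also have "\<dots> = (\<Sum>j\<le>n + 1 + 1. sM ((- 1) ^ j) (\<Sum>i\<le>n + 1. sM ((- 1) ^ i)
        (coface pr lact ract (n + 1) j (coface pr lact ract n i f) t as)))"
    proof (intro sum.cong refl arg_cong[where f = "sM _"])
      fix j assume j: "j \<in> {..n + 1 + 1}"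
      have "del_leaf j t \<in> trees (n + 1)" using trees_del_leaf[of t "n + 1" j] True j by simp
      then show "coface pr lact ract (n + 1) j (coboundary pr sM lact ract n f) t as =
        (\<Sum>i\<le>n + 1. sM ((- 1) ^ i) (coface pr lact ract (n + 1) j (coface pr lact ract n i f) t as))"
        using True j by (intro coface_sum) (auto simp: coboundary_def simp del: sum.atMost_Suc)
    qed
    also have "\<dots> = (\<Sum>j\<le>n + 1 + 1. \<Sum>i\<le>n + 1. sM ((- 1) ^ (i + j))
        (coface pr lact ract (n + 1) j (coface pr lact ract n i f) t as))"
      by (simp add: M.scale_sum_right power_add mult.commute del: sum.atMost_Suc)
    also have "\<dots> = 0"
      by (rule sum_alternating_faces[where n = "n + 1"]) (use coface_coface[OF assms] True in simp)
    finally show ?thesis .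
  next
    case False
    then show ?thesis by (auto simp add: coboundary_def[of _ _ _ _ "Suc n"])
  qed
qed

text \<open>A slot passes through a face either unchanged or multiplied by a fixed neighbour;
  \<open>g\<close> is the identity or this multiplication.\<close>

lemma cochains_linear:
  assumes f: "f \<in> cochains sA sM n" and "t \<in> trees n" "length bs = n" "k < n"
    and g: "Vector_Spaces.linear sA sA g" and "\<And>x. c x = bs[k := g x]"
  shows "Vector_Spaces.linear sA sM (\<lambda>x. f t (c x))"
proof -
  have "Vector_Spaces.linear sA sM (\<lambda>x. f t (bs[k := x]))" using assms by (simp add: cochains_def)
  from Vector_Spaces.linear_compose[OF g this] show ?thesis using assms(6) by (simp add: o_def)
qed

lemma coface_linear:
  assumes f: "f \<in> cochains sA sM n" and t: "t \<in> trees (n + 1)" and len: "length as = n + 1"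
    and k: "k < n + 1" and i: "i \<le> n + 1"
  shows "Vector_Spaces.linear sA sM (\<lambda>x. coface pr lact ract n i f t (as[k := x]))"
proof -
  have d: "del_leaf i t \<in> trees n" using trees_del_leaf t i by blast
  note lin = cochains_linear[OF f d]
  consider "i = 0" "k = 0" | k' where "i = 0" "k = Suc k'" | "i = n + 1" "k = n" "i \<noteq> 0"
    | "i = n + 1" "k < n" "i \<noteq> 0" | "0 < i" "i \<le> n" "k < i - 1" | "0 < i" "i \<le> n" "k = i - 1"
    | "0 < i" "i \<le> n" "k = i" | "0 < i" "i \<le> n" "i < k"
    using i k by atomize_elim presburger
  then show ?thesis
  proof cases
    case 1
    obtain a bs where "as = a # bs" using len by (cases as) auto
    then show ?thesis using 1 bilinear_op_linear(2)[OF bilinear(2)] by (simp add: coface_def)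
  next
    case 2
    obtain a bs where as: "as = a # bs" using len by (cases as) auto
    have "Vector_Spaces.linear sA sM (\<lambda>x. f (del_leaf i t) (bs[k' := x]))"
      by (rule lin[OF _ _ A.linear_ident]) (use as len k 2 in auto)
    then show ?thesis
      using 2 as Vector_Spaces.linear_compose[OF _ bilinear_op_linear(1)[OF bilinear(2)]]
      by (simp add: coface_def o_def)
  next
    case 3
    obtain a bs where "as = bs @ [a]" using len by (cases as rule: rev_cases) auto
    then show ?thesis using 3 len bilinear_op_linear(1)[OF bilinear(3)]
      by (simp add: coface_def list_update_append butlast_append)
  next
    case 4
    obtain a bs where as: "as = bs @ [a]" using len by (cases as rule: rev_cases) auto
    have "Vector_Spaces.linear sA sM (\<lambda>x. f (del_leaf i t) (bs[k := x]))"
      by (rule lin[OF _ _ A.linear_ident]) (use as len k 4 in auto)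
    then show ?thesis
      using 4 as len Vector_Spaces.linear_compose[OF _ bilinear_op_linear(2)[OF bilinear(3)]]
      by (simp add: coface_def o_def list_update_append butlast_append)
  next
    case 5
    let ?c = "pr (tree_op i t) (as ! (i - 1)) (as ! i)"
    show ?thesis
      unfolding coface_def using 5
      by (simp, intro lin[of "take (i - 1) as @ ?c # drop (i + 1) as" k, OF _ _ A.linear_ident])
        (use 5 len in \<open>auto simp: list_update_append take_update_swap\<close>)
  next
    case 6
    show ?thesis
      unfolding coface_def using 6
      \<comment> \<open>Slot \<open>i - 1\<close> is overwritten by the product, so its content is a
        mere placeholder.\<close>
      by (simp, intro lin[of "take (i - 1) as @ undefined # drop (i + 1) as" k,
            OF _ _ bilinear_op_linear(2)[OF bilinear(1), of "tree_op i t" "as ! i"]])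
        (use 6 len in \<open>auto simp: list_update_append\<close>)
  next
    case 7
    show ?thesis
      unfolding coface_def using 7
      by (simp, intro lin[of "take (i - 1) as @ undefined # drop (i + 1) as" "i - 1",
            OF _ _ bilinear_op_linear(1)[OF bilinear(1), of "tree_op i t" "as ! (i - 1)"]])
        (use 7 len in \<open>auto simp: list_update_append\<close>)
  next
    case 8
    then obtain m where m: "k = i + 1 + m" by (metis Suc_eq_plus1 Suc_le_eq le_Suc_ex)
    let ?c = "pr (tree_op i t) (as ! (i - 1)) (as ! i)"
    show ?thesis
      unfolding coface_def using 8
      by (simp, intro lin[of "take (i - 1) as @ ?c # drop (i + 1) as" "k - 1", OF _ _ A.linear_ident])
        (use 8 len k m in \<open>auto simp: list_update_append drop_update_swap\<close>)
  qed
qed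

lemma coboundary_cochains:
  assumes "f \<in> cochains sA sM n"
  shows "coboundary pr sM lact ract n f \<in> cochains sA sM (n + 1)"
proof -
  interpret AM: vector_space_pair sA sM ..
  have "Vector_Spaces.linear sA sM (\<lambda>x. \<Sum>i\<le>n + 1. sM ((- 1) ^ i) (coface pr lact ract n i f t (as[k := x])))"
    if "t \<in> trees (n + 1)" "length as = n + 1" "k < n + 1" for t as k
    by (intro AM.linear_compose_sum ballI AM.linear_compose_scale_right coface_linear)
      (use assms that in auto)
  then show ?thesis by (auto simp: cochains_def coboundary_def simp del: sum.atMost_Suc)
qed

lemma cochains_diff:
  assumes "f \<in> cochains sA sM n" "g \<in> cochains sA sM n"
  shows "(\<lambda>t as. f t as - g t as) \<in> cochains sA sM n"
proof -
  interpret AM: vector_space_pair sA sM ..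
  show ?thesis using assms by (auto simp: cochains_def intro: AM.linear_compose_sub)
qed

end

section \<open>A basis of the free triassociative algebra\<close>

text \<open>A monomial of the free triassociative algebra is a word with a nonempty set of marked letters;
  here \<open>(p, x, r)\<close> has first marked letter \<open>x\<close>, preceded by the unmarked letters \<open>p\<close>.\<close>

type_synonym 'v mword = "'v list \<times> 'v \<times> ('v \<times> bool) list"

definition unmark :: "'v list \<Rightarrow> ('v \<times> bool) list" where
  "unmark = map (\<lambda>v. (v, False))"

fun letters :: "'v mword \<Rightarrow> 'v list" where
  "letters (p, x, r) = p @ x # map fst r"

text \<open>Words are always concatenated; \<open>Lft\<close> keeps the marks of the left factor
  only, \<open>Rgt\<close> those of the right factor, \<open>Mid\<close> both.\<close>

fun mw_mul :: "triop \<Rightarrow> 'v mword \<Rightarrow> 'v mword \<Rightarrow> 'v mword" where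
  "mw_mul Lft (p, x, r) w = (p, x, r @ unmark (letters w))"
| "mw_mul Rgt w (p, x, r) = (letters w @ p, x, r)"
| "mw_mul Mid (p, x, r) (p', x', r') = (p, x, r @ unmark p' @ (x', True) # r')"

lemma unmark_simps [simp]: "unmark [] = []" "unmark (x # xs) = (x, False) # unmark xs"
  "unmark (xs @ ys) = unmark xs @ unmark ys" "map fst (unmark xs) = xs" "length (unmark xs) = length xs"
  by (simp_all add: unmark_def o_def)

lemma letters_mul [simp]: "letters (mw_mul c w w') = letters w @ letters w'"
  by (cases w; cases w'; cases c) auto

lemma triassoc_mw_mul: "triassoc mw_mul mw_mul mw_mul mw_mul"
  by (auto simp: triassoc_def)

definition mw_eval :: "(triop \<Rightarrow> 'a \<Rightarrow> 'a \<Rightarrow> 'a) \<Rightarrow> ('v \<Rightarrow> 'a) \<Rightarrow> 'v mword \<Rightarrow> 'a" where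
  "mw_eval pr \<iota> w = (case w of (p, x, r) \<Rightarrow> foldr (\<lambda>v. pr Rgt (\<iota> v)) p
     (foldl (\<lambda>a (v, b). pr (if b then Mid else Lft) a (\<iota> v)) (\<iota> x) r))"

context
  fixes pr :: "triop \<Rightarrow> 'a \<Rightarrow> 'a \<Rightarrow> 'a" and \<iota> :: "'v \<Rightarrow> 'a"
  assumes tri: "triassoc pr pr pr pr"
begin

private abbreviation "pre p a \<equiv> foldr (\<lambda>v. pr Rgt (\<iota> v)) p a"
private abbreviation "post a r \<equiv> foldl (\<lambda>a (v, b). pr (if b then Mid else Lft) a (\<iota> v)) a r"

text \<open>The identities oriented as rewrite rules towards the bracketing of
  \<open>mw_eval\<close>: \<open>Rgt\<close> factors move to the outside on the left, all others
  nest to the left.\<close>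

private lemma ax:
  "pr Lft x (pr c y z) = pr Lft (pr Lft x y) z"
  "pr c (pr Rgt x y) z = pr Rgt x (pr c y z)"
  "pr Rgt (pr c x y) z = pr Rgt x (pr Rgt y z)"
  "pr Mid x (pr Lft y z) = pr Lft (pr Mid x y) z"
  "pr Mid x (pr Mid y z) = pr Mid (pr Mid x y) z"
  "pr Mid x (pr Rgt y z) = pr Mid (pr Lft x y) z"
  using tri by (cases c; simp add: triassoc_def)+

private lemma pre_mul: "pr c (pre p a) b = pre p (pr c a b)"
  by (induction p) (simp_all add: ax)

private lemma Lft_pre: "pr Lft a (pre p b) = pr Lft (post a (unmark p)) b"
  by (induction p arbitrary: a) (simp_all add: ax)

private lemma Lft_post: "pr Lft a (post b r) = post (pr Lft a b) (unmark (map fst r))"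
  by (induction r rule: rev_induct) (auto simp: ax)

private lemma post_Rgt: "pr Rgt (post a r) b = pr Rgt a (pre (map fst r) b)"
  by (induction r arbitrary: b rule: rev_induct) (auto simp: ax)

private lemma Mid_pre: "pr Mid a (pre p b) = pr Mid (post a (unmark p)) b"
  by (induction p arbitrary: a) (simp_all add: ax)

private lemma Mid_post: "pr Mid a (post b r) = post (pr Mid a b) r"
  by (induction r rule: rev_induct) (auto simp: ax)

lemma mw_eval_mul: "mw_eval pr \<iota> (mw_mul c w w') = pr c (mw_eval pr \<iota> w) (mw_eval pr \<iota> w')"
proof -
  obtain p x r p' x' r' where w: "w = (p, x, r)" "w' = (p', x', r')" by (metis prod_cases3)
  show ?thesis
    by (cases c) (simp_all add: w mw_eval_def pre_mul Lft_pre Lft_post post_Rgt Mid_pre Mid_post)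
qed

end

section \<open>The algebra of marked words and coordinates in it\<close>

lemma linear_eq_on_single:
  assumes "Vector_Spaces.linear pm_scale sC f" "Vector_Spaces.linear pm_scale sC g"
    and "\<And>x. f (Poly_Mapping.single x 1) = g (Poly_Mapping.single x 1)"
  shows "f u = g u"
proof -
  interpret f: Vector_Spaces.linear pm_scale sC f by fact
  interpret g: Vector_Spaces.linear pm_scale sC g by fact
  have "f (Poly_Mapping.single x c) = g (Poly_Mapping.single x c)" for x c
  proof -
    have "Poly_Mapping.single x c = pm_scale c (Poly_Mapping.single x 1)"
      by (intro poly_mapping_eqI) (simp add: lookup_pm_scale lookup_single when_def)
    then show ?thesis using assms(3) by (simp add: f.scale g.scale)
  qed
  moreover have "u = (\<Sum>x\<in>Poly_Mapping.keys u. Poly_Mapping.single x (Poly_Mapping.lookup u x))"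
    by (intro poly_mapping_eqI) (auto simp: lookup_sum lookup_single when_def in_keys_iff sum.If_cases
      if_distrib cong: if_cong)
  ultimately show ?thesis by (metis (no_types, lifting) f.sum g.sum sum.cong)
qed

definition free_mul :: "triop \<Rightarrow> ('v mword \<Rightarrow>\<^sub>0 'k::field) \<Rightarrow> ('v mword \<Rightarrow>\<^sub>0 'k) \<Rightarrow> ('v mword \<Rightarrow>\<^sub>0 'k)" where
  "free_mul c u w = pm_eval pm_scale
     (\<lambda>x. pm_eval pm_scale (\<lambda>y. Poly_Mapping.single (mw_mul c x y) 1) w) u"

lemma free_mul_single:
  "free_mul c (Poly_Mapping.single x 1) (Poly_Mapping.single y 1) = Poly_Mapping.single (mw_mul c x y) 1"
  by (simp add: free_mul_def pm_eval_single vector_space_pm)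

lemma bilinear_free_mul:
  "bilinear_op pm_scale pm_scale (pm_scale :: 'k::field \<Rightarrow> ('v mword \<Rightarrow>\<^sub>0 'k) \<Rightarrow> _) (free_mul c)"
  unfolding bilinear_op_def
proof (intro conjI allI)
  fix u w :: "'v mword \<Rightarrow>\<^sub>0 'k"
  show "Vector_Spaces.linear pm_scale pm_scale (\<lambda>u. free_mul c u w)"
    unfolding free_mul_def by (rule linear_pm_eval) (rule vector_space_pm)
  interpret P: vector_space "pm_scale :: 'k \<Rightarrow> ('v mword \<Rightarrow>\<^sub>0 'k) \<Rightarrow> _" by (rule vector_space_pm)
  interpret PP: vector_space_pair "pm_scale :: 'k \<Rightarrow> ('v mword \<Rightarrow>\<^sub>0 'k) \<Rightarrow> _"
    "pm_scale :: 'k \<Rightarrow> ('v mword \<Rightarrow>\<^sub>0 'k) \<Rightarrow> _" ..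
  show "Vector_Spaces.linear pm_scale pm_scale (free_mul c u)"
    unfolding free_mul_def pm_eval_def[of _ _ u]
    by (intro PP.linear_compose_sum ballI PP.linear_compose_scale_right linear_pm_eval vector_space_pm)
qed

lemma bilinear_eq_on_single:
  assumes "bilinear_op pm_scale pm_scale sZ b" "bilinear_op pm_scale pm_scale sZ b'"
    and "\<And>x y. b (Poly_Mapping.single x 1) (Poly_Mapping.single y 1) =
      b' (Poly_Mapping.single x 1) (Poly_Mapping.single y 1)"
  shows "b u w = b' u w"
proof (rule linear_eq_on_single[OF bilinear_op_linear(1)[OF assms(1)] bilinear_op_linear(1)[OF assms(2)]])
  fix y
  show "b u (Poly_Mapping.single y 1) = b' u (Poly_Mapping.single y 1)"
    by (rule linear_eq_on_single[OF bilinear_op_linear(2)[OF assms(1)] bilinear_op_linear(2)[OF assms(2)]])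
      (rule assms(3))
qed

lemma bilinear_op_comp:
  assumes "bilinear_op sX sY sZ b"
  shows "Vector_Spaces.linear sZ sW f \<Longrightarrow> bilinear_op sX sY sW (\<lambda>x y. f (b x y))"
    and "Vector_Spaces.linear sU sX g \<Longrightarrow> Vector_Spaces.linear sV sY g' \<Longrightarrow>
      bilinear_op sU sV sZ (\<lambda>x y. b (g x) (g' y))"
  using Vector_Spaces.linear_compose[OF bilinear_op_linear(1)[OF assms], of sW f]
    Vector_Spaces.linear_compose[OF bilinear_op_linear(2)[OF assms], of sW f]
    Vector_Spaces.linear_compose[OF _ bilinear_op_linear(1)[OF assms], of sV g']
    Vector_Spaces.linear_compose[OF _ bilinear_op_linear(2)[OF assms], of sU g]
  by (simp_all add: bilinear_op_def o_def)

lemma hom_on_single: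
  assumes f: "Vector_Spaces.linear pm_scale sC f" and b: "bilinear_op sC sC sC (q c)"
    and "\<And>x y. f (Poly_Mapping.single (mw_mul c x y) 1) =
      q c (f (Poly_Mapping.single x 1)) (f (Poly_Mapping.single y 1))"
  shows "f (free_mul c u w) = q c (f u) (f w)"
  by (rule bilinear_eq_on_single[OF bilinear_op_comp(1)[OF bilinear_free_mul f] bilinear_op_comp(2)[OF b f f]])
    (simp add: free_mul_single assms(3))

lemma free_mul_assoc:
  assumes "\<And>x y z :: 'v mword. mw_mul c2 (mw_mul c1 x y) z = mw_mul c3 x (mw_mul c4 y z)"
  shows "free_mul c2 (free_mul c1 (u :: 'v mword \<Rightarrow>\<^sub>0 'k::field) v) w = free_mul c3 u (free_mul c4 v w)"
proof (rule linear_eq_on_single[of pm_scale "free_mul c2 (free_mul c1 u v)"])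
  note lin = bilinear_op_linear[OF bilinear_free_mul]
  show "Vector_Spaces.linear pm_scale pm_scale (free_mul c2 (free_mul c1 u v))" by (rule lin)
  show "Vector_Spaces.linear pm_scale pm_scale (\<lambda>w. free_mul c3 u (free_mul c4 v w))"
    using Vector_Spaces.linear_compose[OF lin(1) lin(1)] by (simp add: o_def)
  fix z
  show "free_mul c2 (free_mul c1 u v) (Poly_Mapping.single z 1) =
      free_mul c3 u (free_mul c4 v (Poly_Mapping.single z 1))"
    by (rule bilinear_eq_on_single[OF bilinear_op_comp(1)[OF bilinear_free_mul lin(2)]
        bilinear_op_comp(2)[OF bilinear_free_mul vector_space.linear_ident[OF vector_space_pm] lin(2)]])
      (simp only: free_mul_single assms)
qed

lemma free_mul_algebra: "triassociative_algebra pm_scale (free_mul :: triop \<Rightarrow> ('v mword \<Rightarrow>\<^sub>0 'k::field) \<Rightarrow> _)"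
  using triassoc_mw_mul
  by (simp add: triassociative_algebra_def vector_space_pm bilinear_free_mul)
    (simp add: triassoc_def, intro conjI allI free_mul_assoc, auto)

text \<open>The word algebra takes every vector of \<open>V\<close> as a letter. This projection
  serves to show that the coordinates of an element only involve letters from a basis of
  \<open>V\<close>.\<close>

definition support_restrict :: "'i set \<Rightarrow> ('i \<Rightarrow>\<^sub>0 'k::field) \<Rightarrow> ('i \<Rightarrow>\<^sub>0 'k)" where
  "support_restrict W = pm_eval pm_scale (\<lambda>x. if x \<in> W then Poly_Mapping.single x 1 else 0)"

lemma keys_support_restrict: "Poly_Mapping.keys (support_restrict W u) \<subseteq> W"
proof
  fix x
  assume "x \<in> Poly_Mapping.keys (support_restrict W u)"
  moreover have "Poly_Mapping.lookup (support_restrict W u) x = 0" if "x \<notin> W"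
    unfolding support_restrict_def pm_eval_def lookup_sum lookup_pm_scale
    by (rule sum.neutral) (use that in \<open>auto simp: lookup_single when_def\<close>)
  ultimately show "x \<in> W" by (auto simp: in_keys_iff)
qed

text \<open>\<open>h\<close> extends the linear map \<open>g\<close> that sends a basis vector to
  its one-letter word. Two uses of uniqueness give the rest: evaluation after \<open>h\<close>
  extends \<open>\<iota>\<close>, so it is the identity; the projection to words over
  \<open>B\<close> is multiplicative, so after \<open>h\<close> it still extends \<open>g\<close>,
  and it therefore fixes the values of \<open>h\<close>.\<close>

lemma free_algebra_basis:
  fixes sV :: "'k::field \<Rightarrow> 'v::ab_group_add \<Rightarrow> 'v" and sA :: "'k \<Rightarrow> 'a::ab_group_add \<Rightarrow> 'a"
  assumes free: "free_triassociative_algebra sV sA pr \<iota>"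
  obtains B and h :: "'a \<Rightarrow> ('v mword \<Rightarrow>\<^sub>0 'k)"
  where "Vector_Spaces.linear sA pm_scale h"
    and "\<And>w. set (letters w) \<subseteq> B \<Longrightarrow> h (mw_eval pr \<iota> w) = Poly_Mapping.single w 1"
    and "\<And>a. a = pm_eval sA (mw_eval pr \<iota>) (h a)"
    and "\<And>a w. w \<in> Poly_Mapping.keys (h a) \<Longrightarrow> set (letters w) \<subseteq> B"
proof -
  note F = free_triassociative_algebra_extension[OF free, unfolded free_extension_def]
  have A: "triassociative_algebra sA pr" and V: "vector_space sV" and \<iota>: "Vector_Spaces.linear sV sA \<iota>"
    using free by (auto simp: free_triassociative_algebra_def)
  then have tri: "triassoc pr pr pr pr" and bil: "\<And>c. bilinear_op sA sA sA (pr c)" and "vector_space sA"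
    by (auto simp: triassociative_algebra_def)
  interpret V: vector_space sV by fact
  interpret A: vector_space sA by fact
  interpret P: vector_space "pm_scale :: 'k \<Rightarrow> ('v mword \<Rightarrow>\<^sub>0 'k) \<Rightarrow> _" by (rule vector_space_pm)
  interpret VP: vector_space_pair sV "pm_scale :: 'k \<Rightarrow> ('v mword \<Rightarrow>\<^sub>0 'k) \<Rightarrow> _" ..
  interpret VA: vector_space_pair sV sA ..
  obtain B where B: "V.independent B" "V.span B = UNIV"
    using V.maximal_independent_subset[of UNIV] by (metis top.extremum_uniqueI)
  obtain g where g: "Vector_Spaces.linear sV pm_scale g"
    "\<And>b. b \<in> B \<Longrightarrow> g b = Poly_Mapping.single (([], b, []) :: 'v mword) (1 :: 'k)"
    using VP.linear_independent_extend[OF B(1), of "\<lambda>b. Poly_Mapping.single ([], b, []) 1"] by blast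
  from F[rule_format, OF free_mul_algebra g(1)] obtain h where h: "triassociative_hom sA pr pm_scale free_mul h"
    and hg: "\<And>v. h (\<iota> v) = g v"
    and h_unique: "\<And>k. triassociative_hom sA pr pm_scale free_mul k \<Longrightarrow> (\<And>v. k (\<iota> v) = g v) \<Longrightarrow> k = h"
    by blast
  have hl: "Vector_Spaces.linear sA pm_scale h" and hm: "\<And>c x y. h (pr c x y) = free_mul c (h x) (h y)"
    using h by (auto simp: triassociative_hom_def)
  define E where "E = (pm_eval sA (mw_eval pr \<iota>) :: ('v mword \<Rightarrow>\<^sub>0 'k) \<Rightarrow> 'a)"
  have El: "Vector_Spaces.linear pm_scale sA E" unfolding E_def by (rule linear_pm_eval) fact
  have E1: "E (Poly_Mapping.single w 1) = mw_eval pr \<iota> w" for w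
    unfolding E_def by (rule pm_eval_single) fact
  have "triassociative_hom pm_scale free_mul sA pr E"
    using hom_on_single[OF El bil] El by (simp add: triassociative_hom_def E1 mw_eval_mul[OF tri])
  from triassociative_hom_comp[OF h this] have Eh: "triassociative_hom sA pr sA pr (\<lambda>a. E (h a))" .
  have "E (h (\<iota> v)) = \<iota> v" for v
  proof -
    have "Vector_Spaces.linear sV sA (\<lambda>v. E (g v))"
      using Vector_Spaces.linear_compose[OF g(1) El] by (simp add: o_def)
    from VA.linear_eq_on_span[OF this \<iota>, of B v] show ?thesis
      using B(2) by (simp add: hg g(2) E1 mw_eval_def)
  qed
  moreover have "triassociative_hom sA pr sA pr (\<lambda>a. a)"
    using A.linear_id by (simp add: triassociative_hom_def id_def)
  ultimately have "(\<lambda>a. E (h a)) = (\<lambda>a. a)"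
    using F[rule_format, OF A \<iota>] Eh by (metis (no_types, lifting))
  then have Eh_id: "E (h a) = a" for a by (rule fun_cong)
  define W where "W = {w. set (letters w) \<subseteq> B}"
  define R where "R = (support_restrict W :: ('v mword \<Rightarrow>\<^sub>0 'k) \<Rightarrow> _)"
  have Rl: "Vector_Spaces.linear pm_scale pm_scale R"
    unfolding R_def support_restrict_def by (rule linear_pm_eval) (rule vector_space_pm)
  have R1: "R (Poly_Mapping.single w 1) = (if w \<in> W then Poly_Mapping.single w 1 else 0)" for w
    unfolding R_def support_restrict_def by (rule pm_eval_single) (rule vector_space_pm)
  have "R (free_mul c u w) = free_mul c (R u) (R w)" for c u w
    by (rule hom_on_single[where q = free_mul, OF Rl bilinear_free_mul])
      (auto simp: R1 free_mul_single W_def bilinear_opD(5,6)[OF bilinear_free_mul])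
  then have "triassociative_hom pm_scale free_mul pm_scale free_mul R"
    using Rl by (simp add: triassociative_hom_def)
  from triassociative_hom_comp[OF h this] have "triassociative_hom sA pr pm_scale free_mul (\<lambda>a. R (h a))" .
  moreover have "R (h (\<iota> v)) = g v" for v
  proof -
    have "Vector_Spaces.linear sV pm_scale (\<lambda>v. R (g v))"
      using Vector_Spaces.linear_compose[OF g(1) Rl] by (simp add: o_def)
    from VP.linear_eq_on_span[OF this g(1), of B v] show ?thesis
      using B(2) by (simp add: hg g(2) R1 W_def)
  qed
  ultimately have "(\<lambda>a. R (h a)) = h" by (rule h_unique)
  then have keys: "Poly_Mapping.keys (h a) \<subseteq> W" for a
    using keys_support_restrict[of W "h a"] by (metis R_def)
  have "h (mw_eval pr \<iota> w) = Poly_Mapping.single w 1" if "set (letters w) \<subseteq> B" for w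
  proof -
    obtain p x r where w: "w = (p, x, r)" by (metis prod_cases3)
    have post: "h (foldl (\<lambda>a (v, b). pr (if b then Mid else Lft) a (\<iota> v)) (\<iota> x) r) = Poly_Mapping.single ([], x, r) 1"
      if "x \<in> B" "fst ` set r \<subseteq> B" for r
      using that by (induction r rule: rev_induct) (auto simp: hg g(2) hm free_mul_single)
    have "h (foldr (\<lambda>v. pr Rgt (\<iota> v)) p a) = Poly_Mapping.single (p, x, r) 1"
      if "set p \<subseteq> B" "h a = Poly_Mapping.single ([], x, r) 1" for a
      using that by (induction p) (auto simp: hg g(2) hm free_mul_single)
    then show ?thesis using that post by (simp add: w mw_eval_def)
  qed
  moreover have "set (letters w) \<subseteq> B" if "w \<in> Poly_Mapping.keys (h a)" for a w
    using subsetD[OF keys that] by (simp add: W_def)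
  ultimately show ?thesis using that[of h B] hl Eh_id[unfolded E_def, symmetric] by blast
qed

section \<open>Multilinear maps and their values on basis words\<close>

fun multilinear_extension ::
  "('k::field \<Rightarrow> 'm::ab_group_add \<Rightarrow> 'm) \<Rightarrow> ('a \<Rightarrow> ('i \<Rightarrow>\<^sub>0 'k)) \<Rightarrow> ('i list \<Rightarrow> 'm) \<Rightarrow> 'a list \<Rightarrow> 'm" where
  "multilinear_extension sM h G [] = G []"
| "multilinear_extension sM h G (a # as) =
     pm_eval sM (\<lambda>u. multilinear_extension sM h (\<lambda>us. G (u # us)) as) (h a)"

lemma multilinear_extension_linear:
  assumes h: "Vector_Spaces.linear sA pm_scale h" and M: "vector_space sM"
  shows "j < length as \<Longrightarrow> Vector_Spaces.linear sA sM (\<lambda>x. multilinear_extension sM h G (as[j := x]))"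
proof (induction as arbitrary: j G)
  case (Cons a as)
  show ?case
  proof (cases j)
    case 0
    then show ?thesis
      using Vector_Spaces.linear_compose[OF h linear_pm_eval[OF M, of "\<lambda>u. multilinear_extension sM h (\<lambda>us. G (u # us)) as"]]
      by (simp add: o_def)
  next
    case (Suc k)
    interpret h: Vector_Spaces.linear sA pm_scale h by fact
    interpret A: vector_space sA by unfold_locales
    interpret M: vector_space sM by fact
    interpret AM: vector_space_pair sA sM ..
    show ?thesis unfolding Suc list_update_code(3) multilinear_extension.simps pm_eval_def
      by (intro AM.linear_compose_sum ballI AM.linear_compose_scale_right Cons.IH)
        (use Cons.prems Suc in simp)
  qed
qed simp

lemma multilinear_extension_basis:
  assumes "\<forall>u\<in>set us. h (ev u) = Poly_Mapping.single u 1" "vector_space sM"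
  shows "multilinear_extension sM h G (map ev us) = G us"
  using assms(1) by (induction us arbitrary: G) (simp_all add: pm_eval_single assms(2))

lemma cochains_eq_on_basis:
  assumes f: "f \<in> cochains sA sM n" "g \<in> cochains sA sM n"
    and h: "\<And>a. a = pm_eval sA ev (h a)" "\<And>a. Poly_Mapping.keys (h a) \<subseteq> W"
    and eq: "\<And>t us. t \<in> trees n \<Longrightarrow> us \<in> lists W \<Longrightarrow> length us = n \<Longrightarrow> f t (map ev us) = g t (map ev us)"
  shows "f = g"
proof (intro ext)
  fix t as
  show "f t as = g t as"
  proof (cases "t \<in> trees n \<and> length as = n")
    case True
    \<comment> \<open>Arguments are expanded in the basis one at a time: \<open>us\<close> is the
      part at the right end that already consists of basis words.\<close>
    have "f t (as @ map ev us) = g t (as @ map ev us)"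
      if "us \<in> lists W" "length as + length us = n" for as us
      using that
    proof (induction as arbitrary: us rule: rev_induct)
      case Nil
      then show ?case using eq True by simp
    next
      case (snoc a as)
      let ?bs = "\<lambda>x. (as @ a # map ev us)[length as := x]"
      have "Vector_Spaces.linear sA sM (\<lambda>x. f t (?bs x))" "Vector_Spaces.linear sA sM (\<lambda>x. g t (?bs x))"
        using f snoc.prems(2) True unfolding cochains_def
        by (auto simp del: list_update_length)
      then interpret f: Vector_Spaces.linear sA sM "\<lambda>x. f t (as @ x # map ev us)"
        + g: Vector_Spaces.linear sA sM "\<lambda>x. g t (as @ x # map ev us)" by simp_all
      have "f t (as @ ev u # map ev us) = g t (as @ ev u # map ev us)" if "u \<in> W" for u
        using snoc.IH[of "u # us"] snoc.prems that by simp
      then have "f t (as @ pm_eval sA ev (h a) # map ev us) = g t (as @ pm_eval sA ev (h a) # map ev us)"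
        using h(2)[of a] by (auto simp: pm_eval_def f.sum g.sum f.scale g.scale intro!: sum.cong)
      then show ?case using h(1)[of a] by simp
    qed
    from this[of "[]" as] show ?thesis using True by simp
  next
    case False
    then show ?thesis using f unfolding cochains_def by force
  qed
qed

section \<open>Trees decorated with marked words\<close>

text \<open>Reads the tail of a marked word as a marked word of its own. This undoes
  \<open>Mid\<close> multiplication by a one-letter word and is meaningful only if \<open>q\<close>
  contains a mark.\<close>

definition split_mark :: "('v \<times> bool) list \<Rightarrow> 'v mword" where
  "split_mark q = (let d = dropWhile (\<lambda>y. \<not> snd y) q in
     (map fst (takeWhile (\<lambda>y. \<not> snd y) q), fst (hd d), tl d))"

definition weight :: "'v mword list \<Rightarrow> nat" where
  "weight us = length (concat (map letters us))"

abbreviation "deg \<equiv> tree_degree"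

text \<open>Inner faces preserve the total product: its marked letters are the marked letters at the root
  vertex. The matching only changes the part of a tree before the second of these letters: it moves
  the cut next to a single unmarked letter there, cuts off the first marked letter, or recurses into
  the first nontrivial one of the two leftmost subtrees.\<close>

function (sequential) lower_tree :: "ptree \<Rightarrow> 'v mword list \<Rightarrow> bool" where
  "lower_tree (Node (t0 # t1 # ts)) us =
     (let us0 = take (deg t0) us; us1 = take (deg t1) (drop (deg t0 + 1) us) in
      if us0 \<noteq> [] then lower_tree t0 us0
      else case us ! deg t0 of (p, x, q) \<Rightarrow>
        p \<noteq> [] \<or> True \<in> snd ` set q \<or> (if us1 \<noteq> [] then lower_tree t1 us1 else q \<noteq> []))"
| "lower_tree t us = False"
  by pat_completeness auto
termination by (relation "measure (size \<circ> fst)") auto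

text \<open>The number returned is the leaf whose deletion leads back. The three new cuts undo the
  three products at leaf 1: an unmarked first letter is split off by \<open>Rgt\<close> as a cherry,
  a marked first letter with a further mark behind it by \<open>Mid\<close>, and the last letter of
  an unmarked \<open>q\<close> by \<open>Lft\<close> as a cherry in second place. The recursion into
  \<open>t1\<close> shifts the leaf number by one because of the trivial first subtree.\<close>

function (sequential) upper_partner :: "ptree \<Rightarrow> 'v mword list \<Rightarrow> nat \<times> ptree \<times> 'v mword list" where
  "upper_partner (Node (t0 # t1 # ts)) us =
     (let us0 = take (deg t0) us; b = us ! deg t0; us1 = take (deg t1) (drop (deg t0 + 1) us);
        r = drop (deg t0 + 1 + deg t1) us in
      if us0 \<noteq> [] then case upper_partner t0 us0 of (i, t', us') \<Rightarrow> (i, Node (t' # t1 # ts), us' @ b # us1 @ r)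
      else case b of (p, x, q) \<Rightarrow>
        if p \<noteq> [] then (1, Node (Node [Leaf, Leaf] # t1 # ts), ([], hd p, []) # (tl p, x, q) # us1 @ r)
        else if True \<in> snd ` set q then (1, Node (Leaf # Leaf # t1 # ts), ([], x, []) # split_mark q # us1 @ r)
        else if us1 \<noteq> [] then case upper_partner t1 us1 of (i, t', us') \<Rightarrow> (i + 1, Node (Leaf # t' # ts), b # us' @ r)
        else (1, Node (Leaf # Node [Leaf, Leaf] # ts), ([], x, butlast q) # ([], fst (last q), []) # r))"
| "upper_partner t us = (0, t, us)"
  by pat_completeness auto
termination by (relation "measure (size \<circ> fst)") auto

text \<open>The summand with the length of the tail is there for a single face: once the last letter
  of the tail is cut off as a cherry, the face at leaf 2 moves this letter on to the right, or drops
  it, and may be lower again, with a tail shorter by one.\<close>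

function (sequential) rank :: "ptree \<Rightarrow> 'v mword list \<Rightarrow> nat" where
  "rank (Node (t0 # t1 # ts)) us = 2 ^ weight us +
     (let us0 = take (deg t0) us; us1 = take (deg t1) (drop (deg t0 + 1) us) in
      if us0 \<noteq> [] then rank t0 us0
      else if us1 \<noteq> [] then rank t1 us1 else length (snd (snd (us ! deg t0))))"
| "rank t us = 0"
  by pat_completeness auto
termination by (relation "measure (size \<circ> fst)") auto

text \<open>Equivalent to \<open>t \<in> trees (length us)\<close>, but it exposes the blocks of
  words belonging to the two leftmost subtrees, along which \<open>lower_tree\<close> and
  \<open>upper_partner\<close> recurse.\<close>

inductive valid :: "ptree \<Rightarrow> 'v mword list \<Rightarrow> bool" where
  Leaf: "valid Leaf []"
| Node: "valid t0 us0 \<Longrightarrow> valid t1 us1 \<Longrightarrow> \<forall>t\<in>set ts. wf_tree t \<Longrightarrow>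
    sum_list (map leaves ts) = length r \<Longrightarrow> valid (Node (t0 # t1 # ts)) (us0 @ (p, x, q) # us1 @ r)"

lemma leaves_pos: "wf_tree t \<Longrightarrow> 0 < leaves t"
proof (induction t rule: wf_tree.induct)
  case (2 ts)
  then show ?case by (cases ts) auto
qed simp

lemma valid_trees: "valid t us \<Longrightarrow> t \<in> trees (length us)"
  by (induction rule: valid.induct) (auto simp: trees_def)

lemma trees_valid: "t \<in> trees (length us) \<Longrightarrow> valid t us"
proof (induction t arbitrary: us rule: wf_tree.induct)
  case 1
  then show ?case by (auto simp: trees_def intro: valid.Leaf)
next
  case (2 ts)
  then obtain t0 t1 ts' where ts: "ts = t0 # t1 # ts'"
    by (cases ts; cases "tl ts") (auto simp: trees_def)
  have wf: "wf_tree t0" "wf_tree t1" "\<forall>t\<in>set ts'. wf_tree t"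
    and len: "leaves t0 + leaves t1 + sum_list (map leaves ts') = length us + 1"
    using 2 ts by (auto simp: trees_def)
  define m0 m1 where m: "m0 = leaves t0 - 1" "m1 = leaves t1 - 1"
  note pos = leaves_pos[OF wf(1)] leaves_pos[OF wf(2)]
  obtain p x q where pxq: "us ! m0 = (p, x, q)" by (metis prod_cases3)
  have us: "us = take m0 us @ (p, x, q) # take m1 (drop (m0 + 1) us) @ drop (m0 + 1 + m1) us"
    using id_take_nth_drop[of m0 us] m len pos pxq append_take_drop_id[of m1 "drop (m0 + 1) us"]
    by (simp add: add.commute)
  have "valid t0 (take m0 us)" "valid t1 (take m1 (drop (m0 + 1) us))"
    using 2(1)[of t0 "take m0 us"] 2(1)[of t1 "take m1 (drop (m0 + 1) us)"] ts wf m len pos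
    by (auto simp: trees_def)
  moreover have "sum_list (map leaves ts') = length (drop (m0 + 1 + m1) us)" using m len pos by simp
  ultimately show ?case using valid.Node[of t0 _ t1] wf(3) ts us by metis
qed

lemma valid_deg:
  assumes "valid t us"
  shows "deg t = length us" "leaves t = length us + 1" "wf_tree t"
  using valid_trees[OF assms] by (auto simp: trees_def tree_degree_def)

lemma valid_Leaf_iff: "valid t us \<Longrightarrow> t = Leaf \<longleftrightarrow> us = []"
  by (cases rule: valid.cases) auto

text \<open>\<open>leaf_op\<close> agrees with \<open>tree_op\<close> on inner leaves and, unlike
  it, passes to subtrees, whose outer leaves may be inner leaves of the whole tree.\<close>

definition word_face :: "nat \<Rightarrow> ptree \<Rightarrow> 'v mword list \<Rightarrow> 'v mword list" where
  "word_face i t us = (if i = 0 then tl us else if i < length us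
     then take (i - 1) us @ mw_mul (leaf_op i t) (us ! (i - 1)) (us ! i) # drop (i + 1) us
     else butlast us)"

lemma length_word_face: "us \<noteq> [] \<Longrightarrow> length (word_face i t us) = length us - 1"
  by (auto simp: word_face_def)

lemma valid_word_face: "valid t us \<Longrightarrow> us \<noteq> [] \<Longrightarrow> i \<le> length us \<Longrightarrow> valid (del_leaf i t) (word_face i t us)"
  using trees_del_leaf[of t "length us - 1" i] valid_trees[of t us]
  by (intro trees_valid) (auto simp: length_word_face)

lemma letters_nonempty [simp]: "letters w \<noteq> []"
  by (cases w) auto

lemma letters_word_face_merge:
  assumes "0 < i" "i < length us"
  shows "concat (map letters (word_face i t us)) = concat (map letters us)"
proof -
  have "us = take (i - 1) us @ us ! (i - 1) # us ! i # drop (i + 1) us"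
    using assms id_take_nth_drop[of "i - 1" us] Cons_nth_drop_Suc[of i us] by simp
  then have "concat (map letters us) =
      concat (map letters (take (i - 1) us @ us ! (i - 1) # us ! i # drop (i + 1) us))"
    by (rule arg_cong)
  then show ?thesis using assms by (simp add: word_face_def)
qed

lemma weight_simps [simp]: "weight [] = 0" "weight (u # us) = length (letters u) + weight us"
  "weight (us @ vs) = weight us + weight vs"
  by (simp_all add: weight_def)

lemma length_le_weight: "length us \<le> weight us"
proof (induction us)
  case (Cons u us)
  then show ?case by (cases u) simp
qed simp

lemma weight_word_face_outer:
  assumes "us \<noteq> []"
  shows "weight (word_face 0 t us) < weight us" "weight (word_face (length us) t us) < weight us"
proof -
  show "weight (word_face 0 t us) < weight us" using assms by (cases us) (simp_all add: word_face_def)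
  show "weight (word_face (length us) t us) < weight us"
    using assms by (cases us rule: rev_cases) (simp_all add: word_face_def)
qed

lemma weight_word_face: "us \<noteq> [] \<Longrightarrow> i \<le> length us \<Longrightarrow> weight (word_face i t us) \<le> weight us"
  using weight_word_face_outer[of us t] letters_word_face_merge[of i us t]
  by (cases "i = 0"; cases "i = length us") (auto simp: weight_def)

lemma eval_Node0:
  assumes "length us0 = deg t0" "us0 \<noteq> []" "ts \<noteq> []"
  shows "lower_tree (Node (t0 # ts)) (us0 @ w) = lower_tree t0 us0"
    "rank (Node (t0 # ts)) (us0 @ w) = 2 ^ weight (us0 @ w) + rank t0 us0"
  using assms by (cases ts; simp add: Let_def)+

lemma eval_Node1:
  assumes "length us1 = deg t1"
  shows "lower_tree (Node (Leaf # t1 # ts)) ((p, x, q) # us1 @ w) \<longleftrightarrow>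
      p \<noteq> [] \<or> True \<in> snd ` set q \<or> (if us1 \<noteq> [] then lower_tree t1 us1 else q \<noteq> [])"
    "rank (Node (Leaf # t1 # ts)) ((p, x, q) # us1 @ w) =
      2 ^ weight ((p, x, q) # us1 @ w) + (if us1 \<noteq> [] then rank t1 us1 else length q)"
  using assms by (simp_all add: Let_def tree_degree_def)

text \<open>Since \<open>rank\<close> is between \<open>2 ^ weight\<close> and \<open>2 ^ (weight + 1)\<close>, it compares first the number of
  letters and then, recursively, the subtree in which the matching acts.\<close>

lemma rank_bound: "valid t us \<Longrightarrow> rank t us < 2 ^ (weight us + 1)"
proof (induction rule: valid.induct)
  case (Node t0 us0 t1 us1 ts r p x q)
  let ?us = "us0 @ (p, x, q) # us1 @ r"
  note d = valid_deg(1)[OF Node(1)] valid_deg(1)[OF Node(2)]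
  have le: "rank t us < 2 ^ weight ?us" if "rank t us < 2 ^ (weight us + 1)" "weight us + 1 \<le> weight ?us" for t and us :: "'a mword list"
    using that by (meson order.strict_trans2 one_le_numeral power_increasing)
  show ?case
  proof (cases "us0 = []")
    case False
    have "rank t0 us0 < 2 ^ weight ?us" by (rule le[OF Node.IH(1)]) simp
    then show ?thesis using eval_Node0(2)[of us0 t0 "t1 # ts" "(p, x, q) # us1 @ r"] False d by simp
  next
    case True
    then have "t0 = Leaf" using valid_Leaf_iff Node(1) by blast
    moreover have "rank t1 us1 < 2 ^ weight ?us" by (rule le[OF Node.IH(2)]) simp
    moreover have "length q < 2 ^ weight ?us"
      by (rule le_less_trans[OF _ less_exp]) simp
    ultimately show ?thesis using eval_Node1(2)[of us1 t1 ts p x q r] True d by auto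
  qed
qed simp

lemma rank_ge: "valid t us \<Longrightarrow> us \<noteq> [] \<Longrightarrow> 2 ^ weight us \<le> rank t us"
  by (cases rule: valid.cases) auto

lemma rank_less: "valid t us \<Longrightarrow> valid s vs \<Longrightarrow> us \<noteq> [] \<Longrightarrow> weight vs < weight us \<Longrightarrow> rank s vs < rank t us"
  using rank_bound[of s vs] rank_ge[of t us] power_increasing[of "weight vs + 1" "weight us" "2 :: nat"]
  by linarith

lemma leaf_op_outer:
  assumes "valid t us" "us \<noteq> []"
  shows "leaf_op 0 t = Lft" "leaf_op (length us) t = Rgt"
proof -
  obtain l where l: "levels 0 t l" "length l = length us" using trees_levels valid_trees[OF assms(1)] by blast
  have t: "t \<noteq> Leaf" using assms valid_Leaf_iff by blast
  have pos: "\<forall>x\<in>set l. 0 < x" and ne: "l \<noteq> []" using levels_shape(1)[OF l(1)] l(2) assms(2) by auto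
  have "0 < l ! 0" "0 < l ! (length l - 1)" using pos ne by simp_all
  then show "leaf_op 0 t = Lft" "leaf_op (length us) t = Rgt"
    using levels_leaf_op(1)[OF l(1) t, of 0] levels_leaf_op(1)[OF l(1) t, of "length us"] l(2) ne
    by (auto simp: cmp_def nth_append nth_Cons')
qed

text \<open>At \<open>j = length us0\<close> the rightmost leaf of \<open>t0\<close> is an inner
  leaf of the whole tree, right oriented by \<open>leaf_op_outer\<close>, so the last word of the
  block is absorbed into the prefix of \<open>b\<close>.\<close>

lemma face_first:
  assumes "valid t0 us0" "us0 \<noteq> []" "j \<le> length us0"
  shows "del_leaf j (Node (t0 # t1 # ts)) = Node (del_leaf j t0 # t1 # ts)"
    "word_face j (Node (t0 # t1 # ts)) (us0 @ b # w) =
       word_face j t0 us0 @ (if j < length us0 then b else mw_mul Rgt (last us0) b) # w"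
proof -
  have t0: "t0 \<noteq> Leaf" using assms valid_Leaf_iff by blast
  note d = valid_deg[OF assms(1)]
  show "del_leaf j (Node (t0 # t1 # ts)) = Node (del_leaf j t0 # t1 # ts)" using t0 d assms(3) by simp
  have op: "leaf_op j (Node (t0 # t1 # ts)) = leaf_op j t0" using t0 d assms(3) by simp
  show "word_face j (Node (t0 # t1 # ts)) (us0 @ b # w) =
       word_face j t0 us0 @ (if j < length us0 then b else mw_mul Rgt (last us0) b) # w"
    using assms(2,3) op leaf_op_outer(2)[OF assms(1,2)]
    by (cases "j = length us0") (auto simp: word_face_def nth_append last_conv_nth butlast_conv_take simp del: leaf_op.simps)
qed

text \<open>The block of \<open>t0\<close> survives intact. With \<open>ts' = []\<close> the root is
  suppressed and \<open>t0\<close> is all that remains.\<close>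

lemma face_later:
  assumes "valid t0 us0" "valid (Node (t0 # t1 # ts)) (us0 @ b # w)" "length us0 < j" "j \<le> length (us0 @ b # w)"
  obtains ts' w' where "del_leaf j (Node (t0 # t1 # ts)) = suppress (t0 # ts')"
    "word_face j (Node (t0 # t1 # ts)) (us0 @ b # w) = us0 @ w'" "ts' = [] \<Longrightarrow> w' = []"
proof -
  note d = valid_deg[OF assms(1)]
  let ?f = "word_face j (Node (t0 # t1 # ts)) (us0 @ b # w)"
  let ?ts = "del_forest (j - leaves t0) (t1 # ts)"
  have del: "del_leaf j (Node (t0 # t1 # ts)) = suppress (t0 # ?ts)" using d assms(3) by simp
  have w: "?f = us0 @ drop (length us0) ?f"
    using assms(3,4) by (auto simp: word_face_def nth_append butlast_append)
  have "valid (suppress (t0 # ?ts)) ?f" using valid_word_face[OF assms(2) _ assms(4)] del by simp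
  then have "drop (length us0) ?f = []" if "?ts = []"
    using valid_deg(2)[of "suppress (t0 # ?ts)" ?f] d(2) that by (simp del: del_forest.simps)
  then show ?thesis using that del w by blast
qed

text \<open>At \<open>j = 0\<close> the first word of the block joins \<open>b\<close> by
  \<open>Lft\<close>, so it adds only unmarked letters; at \<open>j = length us1\<close> the last
  word passes into \<open>r\<close> or, if \<open>r\<close> is empty, is lost.\<close>

lemma face_second:
  assumes "valid t1 us1" "us1 \<noteq> []" "j \<le> length us1" "sum_list (map leaves ts) = length r"
  obtains r' where
    "del_leaf (j + 1) (Node (Leaf # t1 # ts)) = Node (Leaf # del_leaf j t1 # ts)"
    "word_face (j + 1) (Node (Leaf # t1 # ts)) (b # us1 @ r) =
       (if j = 0 then mw_mul Lft b (hd us1) else b) # word_face j t1 us1 @ r'" "j < length us1 \<Longrightarrow> r' = r"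
proof -
  have t1: "t1 \<noteq> Leaf" using assms valid_Leaf_iff by blast
  note d = valid_deg[OF assms(1)]
  define r' where "r' = (if j < length us1 \<or> r = [] then r
    else mw_mul (leaf_op j t1) (last us1) (hd r) # tl r)"
  have del: "del_leaf (j + 1) (Node (Leaf # t1 # ts)) = Node (Leaf # del_leaf j t1 # ts)"
    using t1 d assms(3) by simp
  have op: "leaf_op (Suc j) (Node (Leaf # t1 # ts)) = leaf_op j t1" using t1 d assms(3) by simp
  have "word_face (j + 1) (Node (Leaf # t1 # ts)) (b # us1 @ r) =
       (if j = 0 then mw_mul Lft b (hd us1) else b) # word_face j t1 us1 @ r'"
  proof (cases "j = 0")
    case True
    then show ?thesis using assms op leaf_op_outer(1)[OF assms(1,2)]
      by (cases us1) (auto simp: word_face_def r'_def simp del: leaf_op.simps)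
  next
    case False
    then show ?thesis
      using assms(2,3) op
      by (cases "j = length us1"; cases r)
        (auto simp: word_face_def r'_def nth_append last_conv_nth butlast_conv_take nth_Cons' take_Cons'
          simp del: leaf_op.simps)
  qed
  then show ?thesis using that[of r'] del by (simp add: r'_def)
qed

lemma face_rest:
  assumes "valid t1 us1" "length us1 + 1 < j" "j \<le> length (b # us1 @ r)"
  obtains ts' r' where "del_leaf j (Node (Leaf # t1 # ts)) = Node (Leaf # t1 # ts')"
    "word_face j (Node (Leaf # t1 # ts)) (b # us1 @ r) = b # us1 @ r'"
proof -
  note d = valid_deg[OF assms(1)]
  let ?f = "word_face j (Node (Leaf # t1 # ts)) (b # us1 @ r)"
  have "?f = b # us1 @ drop (1 + length us1) ?f"
    using assms(2,3) by (auto simp: word_face_def nth_append butlast_append nth_Cons' take_Cons')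
  moreover have "del_leaf j (Node (Leaf # t1 # ts)) = Node (Leaf # t1 # del_forest (j - 1 - leaves t1) ts)"
    using d assms(2) by auto
  ultimately show ?thesis using that by blast
qed

lemma split_mark:
  assumes "True \<in> snd ` set q"
  shows "mw_mul Mid ([], x, []) (split_mark q) = ([], x, q)" "x # letters (split_mark q) = letters ([], x, q)"
proof -
  let ?d = "dropWhile (\<lambda>y. \<not> snd y) q" and ?t = "takeWhile (\<lambda>y. \<not> snd y) q"
  have d: "?d \<noteq> []" "snd (hd ?d)" using assms hd_dropWhile[of "\<lambda>y. \<not> snd y" q] by force+
  have "unmark (map fst ?t) = ?t"
    unfolding unmark_def by (auto intro!: map_idI dest: set_takeWhileD simp: prod_eq_iff)
  moreover have "(fst (hd ?d), True) # tl ?d = ?d" using d by (metis list.collapse prod.collapse)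
  ultimately have "unmark (map fst ?t) @ (fst (hd ?d), True) # tl ?d = q" by simp
  then show "mw_mul Mid ([], x, []) (split_mark q) = ([], x, q)" by (simp add: split_mark_def Let_def)
  then show "x # letters (split_mark q) = letters ([], x, q)"
    by (metis letters.simps letters_mul append_Cons append_Nil list.map(1))
qed

section \<open>An acyclic matching\<close>

text \<open>The bounds on \<open>i\<close> make it an inner face of \<open>s\<close>, which has one
  angle more than \<open>t\<close>. The last clause is the acyclicity: only faces of smaller rank
  can again be lower.\<close>

definition matched :: "ptree \<Rightarrow> 'v mword list \<Rightarrow> nat \<Rightarrow> ptree \<Rightarrow> 'v mword list \<Rightarrow> bool" where
  "matched t us i s vs \<longleftrightarrow>
     0 < i \<and> i \<le> length us \<and> valid s vs \<and> length vs = length us + 1 \<and> \<not> lower_tree s vs \<and>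
     concat (map letters vs) = concat (map letters us) \<and> del_leaf i s = t \<and> word_face i s vs = us \<and>
     (\<forall>j\<le>length vs. j \<noteq> i \<longrightarrow>
        \<not> lower_tree (del_leaf j s) (word_face j s vs) \<or> rank (del_leaf j s) (word_face j s vs) < rank t us)"

text \<open>The other faces of the partner are of three kinds. Those inside the subtree of a
  recursion are settled by the induction hypothesis. Face 0, if not among these, loses letters, so
  its rank is smaller. Those further to the right leave the part that makes the partner upper
  untouched. The one exception is face 2 in case \<open>D\<close>, where the tail gets
  shorter.\<close>

lemma up_matched: "valid t us \<Longrightarrow> lower_tree t us \<Longrightarrow> upper_partner t us = (i, s, vs) \<Longrightarrow> matched t us i s vs"
proof (induction arbitrary: i s vs rule: valid.induct)
  case Leaf
  then show ?case by simp
next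
  case (Node t0 us0 t1 us1 ts r p x q)
  let ?t = "Node (t0 # t1 # ts)" and ?us = "us0 @ (p, x, q) # us1 @ r"
  note d0 = valid_deg[OF Node.hyps(1)] and d1 = valid_deg[OF Node.hyps(2)]
  \<comment> \<open>No face gains letters, so a comparison of the second summands of
    \<open>rank\<close> suffices.\<close>
  have rank_le: "2 ^ weight (word_face j s' vs') + a < 2 ^ weight ?us + b"
    if "a < b" "weight vs' = weight ?us" "vs' \<noteq> []" "j \<le> length vs'" for j s' and a b :: nat and vs' :: "'a mword list"
  proof -
    have "(2 :: nat) ^ weight (word_face j s' vs') \<le> 2 ^ weight ?us"
      using weight_word_face[of vs' j s'] that by (intro power_increasing) auto
    then show ?thesis using that(1) by linarith
  qed
  have outer: "rank (del_leaf 0 s') (word_face 0 s' vs') < rank ?t ?us"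
    if "valid s' vs'" "weight vs' = weight ?us" "vs' \<noteq> []" for s' and vs' :: "'a mword list"
    by (rule rank_less[OF valid.Node[OF Node.hyps] valid_word_face])
      (use that weight_word_face_outer(1)[of vs' s'] in auto)
  show ?case
  proof (cases "us0 = []")
    case us0: False
    obtain t0' us0' where up0: "upper_partner t0 us0 = (i, t0', us0')" and s: "s = Node (t0' # t1 # ts)"
      and vs: "vs = us0' @ (p, x, q) # us1 @ r"
      using Node.prems(2) d0 d1 us0 by (auto simp: Let_def split: prod.splits)
    have low0: "lower_tree t0 us0" using Node.prems(1) eval_Node0(1)[of us0 t0] d0 us0 by simp
    have "matched t0 us0 i t0' us0'" by (rule Node.IH(1)[OF low0 up0])
    then have M: "0 < i" "i \<le> length us0" "valid t0' us0'" "length us0' = length us0 + 1" "\<not> lower_tree t0' us0'"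
      "concat (map letters us0') = concat (map letters us0)" "del_leaf i t0' = t0" "word_face i t0' us0' = us0"
      and other: "\<And>j. j \<le> length us0' \<Longrightarrow> j \<noteq> i \<Longrightarrow> \<not> lower_tree (del_leaf j t0') (word_face j t0' us0') \<or>
        rank (del_leaf j t0') (word_face j t0' us0') < rank t0 us0"
      by (auto simp: matched_def)
    have val: "valid s vs" unfolding s vs by (rule valid.Node) (use M Node.hyps in auto)
    have ne: "us0' \<noteq> []" using M(4) by auto
    note first = face_first[OF M(3) ne]
    show ?thesis unfolding matched_def
    proof (intro conjI allI impI)
      show "\<not> lower_tree s vs" using eval_Node0(1)[of us0' t0' "t1 # ts"] valid_deg[OF M(3)] ne M(5) by (simp add: s vs)
      show "del_leaf i s = ?t" using first(1)[of i] M by (simp add: s)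
      show "word_face i s vs = ?us" using first(2)[of i] M by (simp add: s vs)
      fix j assume j: "j \<le> length vs" "j \<noteq> i"
      show "\<not> lower_tree (del_leaf j s) (word_face j s vs) \<or> rank (del_leaf j s) (word_face j s vs) < rank ?t ?us"
      proof (cases "j \<le> length us0'")
        case True
        define b where "b = (if j < length us0' then (p, x, q) else mw_mul Rgt (last us0') (p, x, q))"
        have f: "del_leaf j s = Node (del_leaf j t0' # t1 # ts)" "word_face j s vs = word_face j t0' us0' @ b # us1 @ r"
          using first[OF True] by (simp_all add: s vs b_def)
        have v: "valid (del_leaf j t0') (word_face j t0' us0')" by (rule valid_word_face[OF M(3) ne True])
        have n: "word_face j t0' us0' \<noteq> []" using length_word_face[OF ne, of j t0'] M(4) us0 by auto
        have e: "lower_tree (del_leaf j s) (word_face j s vs) = lower_tree (del_leaf j t0') (word_face j t0' us0')"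
          "rank (del_leaf j s) (word_face j s vs) = 2 ^ weight (word_face j s vs) + rank (del_leaf j t0') (word_face j t0' us0')"
          using eval_Node0[of "word_face j t0' us0'" "del_leaf j t0'" "t1 # ts" "b # us1 @ r"] valid_deg(1)[OF v] n
          unfolding f by simp_all
        have e': "rank ?t ?us = 2 ^ weight ?us + rank t0 us0"
          using eval_Node0(2)[of us0 t0 "t1 # ts"] d0 us0 by simp
        have "weight vs = weight ?us" using M(6) by (simp add: vs weight_def)
        then show ?thesis
          using other[OF True j(2)] rank_le[of _ _ vs j s] j(1) unfolding e e' by (auto simp: vs)
      next
        case False
        \<comment> \<open>The upper block \<open>us0'\<close> on \<open>t0'\<close> still comes
          first, so the face is upper, also when it is reduced to \<open>t0'\<close> itself.\<close>
        obtain ts' w' where f: "del_leaf j s = suppress (t0' # ts')" "word_face j s vs = us0' @ w'" "ts' = [] \<Longrightarrow> w' = []"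
          using face_later[OF M(3) val[unfolded s vs]] False j(1) unfolding s vs by (metis not_le)
        have "\<not> lower_tree (del_leaf j s) (word_face j s vs)"
          using f M(5) eval_Node0(1)[of us0' t0' ts' w'] valid_deg(1)[OF M(3)] ne
          by (cases ts') auto
        then show ?thesis by simp
      qed
    qed (use M val in \<open>auto simp: vs\<close>)
  next
    case us0: True
    then have t0: "t0 = Leaf" using valid_Leaf_iff Node.hyps(1) by blast
    have bullet: "valid (Node [Leaf, Leaf]) [([], y, [])]" for y :: 'a
      using valid.Node[OF valid.Leaf valid.Leaf, of "[]" "[]" "[]" y "[]"] by simp
    have dbul: "deg (Node [Leaf, Leaf]) = Suc 0" by (simp add: tree_degree_def)
    have bullet': "\<not> lower_tree (Node [Leaf, Leaf]) [([], y, [])]" for y :: 'a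
      by (simp add: tree_degree_def)
    consider (A) y p' where "p = y # p'" | (B) "p = []" "True \<in> snd ` set q"
      | (C) "p = []" "True \<notin> snd ` set q" "us1 \<noteq> []" | (D) "p = []" "True \<notin> snd ` set q" "us1 = []"
      by (cases p) auto
    then show ?thesis
    proof cases
      case A
      let ?bt = "Node [Leaf, Leaf]" and ?bu = "[([], y, [])] :: 'a mword list"
      have i: "i = 1" and s: "s = Node (?bt # t1 # ts)" and vs: "vs = ?bu @ (p', x, q) # us1 @ r"
        using Node.prems(2) A us0 t0 d1 by (auto simp: Let_def tree_degree_def)
      have val: "valid s vs" unfolding s vs by (rule valid.Node[OF bullet]) (use Node.hyps in auto)
      show ?thesis unfolding matched_def
      proof (intro conjI allI impI)
        show "\<not> lower_tree s vs" using eval_Node0(1)[of ?bu ?bt "t1 # ts" "(p', x, q) # us1 @ r"] bullet'[of y]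
          by (simp add: s vs dbul del: lower_tree.simps)
        show "del_leaf i s = ?t" by (simp add: s i t0)
        show "word_face i s vs = ?us" by (simp add: s i vs us0 A word_face_def)
        fix j assume j: "j \<le> length vs" "j \<noteq> i"
        show "\<not> lower_tree (del_leaf j s) (word_face j s vs) \<or> rank (del_leaf j s) (word_face j s vs) < rank ?t ?us"
        proof (cases "j = 0")
          case True
          then show ?thesis using outer[OF val] A us0 by (simp add: vs)
        next
          case False
          then have "length ?bu < j" using j i by simp
          then obtain ts' w' where f: "del_leaf j s = suppress (?bt # ts')" "word_face j s vs = ?bu @ w'"
            "ts' = [] \<Longrightarrow> w' = []"
            using face_later[OF bullet val[unfolded s vs]] j(1) unfolding s vs by metis
          have "\<not> lower_tree (del_leaf j s) (word_face j s vs)"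
            using f bullet'[of y] eval_Node0(1)[of ?bu ?bt ts' w'] dbul
            by (cases ts') (auto simp del: lower_tree.simps)
          then show ?thesis by simp
        qed
      qed (use val i A us0 in \<open>auto simp: vs\<close>)
    next
      case B
      obtain p2 y q2 where sp: "split_mark q = (p2, y, q2)" by (metis prod_cases3)
      note spl = split_mark[OF B(2), of x, unfolded sp]
      have i: "i = 1" and s: "s = Node (Leaf # Leaf # t1 # ts)"
        and vs: "vs = ([], x, []) # (p2, y, q2) # us1 @ r"
        using Node.prems(2) B us0 t0 d1 sp by (auto simp: Let_def tree_degree_def)
      have val: "valid s vs"
        using valid.Node[OF valid.Leaf valid.Leaf, of "t1 # ts" "(p2, y, q2) # us1 @ r" "[]" x "[]"] Node.hyps d1
        by (simp add: s vs)
      \<comment> \<open>With a single marked letter in front and a leaf as second subtree, the tree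
        is upper whatever follows.\<close>
      note nonlow = eval_Node1(1)[of "[]" Leaf _ "[]" x "[]"]
      show ?thesis unfolding matched_def
      proof (intro conjI allI impI)
        show "\<not> lower_tree s vs" using nonlow by (simp add: s vs tree_degree_def)
        show "del_leaf i s = ?t" by (simp add: s i t0)
        show "word_face i s vs = ?us" using spl(1) B(1) by (simp add: s i vs us0 word_face_def)
        fix j assume j: "j \<le> length vs" "j \<noteq> i"
        show "\<not> lower_tree (del_leaf j s) (word_face j s vs) \<or> rank (del_leaf j s) (word_face j s vs) < rank ?t ?us"
        proof (cases "j = 0")
          case True
          have "weight vs = weight ?us" using arg_cong[OF spl(2), of length] us0 B(1) by (simp add: vs)
          then show ?thesis using True outer[OF val] by (simp add: vs)
        next
          case False
          obtain ts' w' where "del_leaf j s = Node (Leaf # Leaf # ts')" "word_face j s vs = ([], x, []) # [] @ w'"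
            using face_rest[OF valid.Leaf, of j "([], x, [])" "(p2, y, q2) # us1 @ r" "t1 # ts"] False j i
            by (auto simp: s vs)
          then have "\<not> lower_tree (del_leaf j s) (word_face j s vs)"
            using nonlow[of ts' w'] by (simp add: tree_degree_def)
          then show ?thesis by simp
        qed
      qed (use val i B us0 spl(2) in \<open>auto simp: vs\<close>)
    next
      case C
      obtain k t1' us1' where up1: "upper_partner t1 us1 = (k, t1', us1')" and i: "i = k + 1"
        and s: "s = Node (Leaf # t1' # ts)" and vs: "vs = ([], x, q) # us1' @ r"
        using Node.prems(2) d1 us0 t0 C by (auto simp: Let_def tree_degree_def split: prod.splits)
      have low1: "lower_tree t1 us1"
        using Node.prems(1) eval_Node1(1)[of us1 t1 ts p x q r] d1 us0 t0 C by simp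
      have "matched t1 us1 k t1' us1'" by (rule Node.IH(2)[OF low1 up1])
      then have M: "0 < k" "k \<le> length us1" "valid t1' us1'" "length us1' = length us1 + 1" "\<not> lower_tree t1' us1'"
        "concat (map letters us1') = concat (map letters us1)" "del_leaf k t1' = t1" "word_face k t1' us1' = us1"
        and other: "\<And>j. j \<le> length us1' \<Longrightarrow> j \<noteq> k \<Longrightarrow> \<not> lower_tree (del_leaf j t1') (word_face j t1' us1') \<or>
          rank (del_leaf j t1') (word_face j t1' us1') < rank t1 us1"
        by (auto simp: matched_def)
      have val: "valid s vs"
        using valid.Node[OF valid.Leaf M(3), of ts r "[]" x q] Node.hyps by (simp add: s vs)
      have ne: "us1' \<noteq> []" using M(4) by auto
      note second = face_second[OF M(3) ne _ Node.hyps(4), of _ "([], x, q)"]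
      have w: "weight vs = weight ?us" using M(6) us0 C(1) by (simp add: vs weight_def)
      show ?thesis unfolding matched_def
      proof (intro conjI allI impI)
        show "\<not> lower_tree s vs" using eval_Node1(1)[of us1' t1' ts "[]" x q r] valid_deg(1)[OF M(3)] ne M(5) C(2)
          by (simp add: s vs)
        obtain r' where "del_leaf (k + 1) s = Node (Leaf # del_leaf k t1' # ts)"
            "word_face (k + 1) s vs = (if k = 0 then mw_mul Lft ([], x, q) (hd us1') else ([], x, q)) # word_face k t1' us1' @ r'"
            "k < length us1' \<Longrightarrow> r' = r"
          using second[of k] M unfolding s vs by (metis trans_le_add1)
        then show "del_leaf i s = ?t" "word_face i s vs = ?us" using M us0 t0 C i by simp_all
        fix j assume j: "j \<le> length vs" "j \<noteq> i"
        consider "j = 0" | j' where "j = j' + 1" "j' \<le> length us1'" | "length us1' + 1 < j"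
          by (metis Suc_eq_plus1 Suc_leI not_less not0_implies_Suc add_le_cancel_right)
        then show "\<not> lower_tree (del_leaf j s) (word_face j s vs) \<or> rank (del_leaf j s) (word_face j s vs) < rank ?t ?us"
        proof cases
          case 1
          then show ?thesis using outer[OF val w] by (simp add: vs)
        next
          case (2 j')
          define b where "b = (if j' = 0 then mw_mul Lft ([], x, q) (hd us1') else ([], x, q))"
          \<comment> \<open>The tail of the first word may grow, but it stays free of marks, so the
            second subtree still decides.\<close>
          define q' where "q' = (if j' = 0 then q @ unmark (letters (hd us1')) else q)"
          have b: "b = ([], x, q')" "True \<notin> snd ` set q'"
            using C(2) by (auto simp: b_def q'_def unmark_def)
          obtain r' where f: "del_leaf j s = Node (Leaf # del_leaf j' t1' # ts)"
            "word_face j s vs = b # word_face j' t1' us1' @ r'"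
            using second[OF 2(2)] unfolding s vs 2(1) b_def by metis
          have v: "valid (del_leaf j' t1') (word_face j' t1' us1')" by (rule valid_word_face[OF M(3) ne 2(2)])
          have n: "word_face j' t1' us1' \<noteq> []" using length_word_face[OF ne, of j' t1'] M(4) C(3) by auto
          have e: "lower_tree (del_leaf j s) (word_face j s vs) = lower_tree (del_leaf j' t1') (word_face j' t1' us1')"
            "rank (del_leaf j s) (word_face j s vs) = 2 ^ weight (word_face j s vs) + rank (del_leaf j' t1') (word_face j' t1' us1')"
            using eval_Node1[of "word_face j' t1' us1'" "del_leaf j' t1'" ts "[]" x q' r'] valid_deg(1)[OF v] n b
            unfolding f by simp_all
          have e': "rank ?t ?us = 2 ^ weight ?us + rank t1 us1"
            using eval_Node1(2)[of us1 t1 ts p x q r] d1 us0 t0 C by simp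
          show ?thesis
            using other[OF 2(2)] rank_le[OF _ w, of _ _ j s] j 2 i unfolding e e' by (auto simp: vs)
        next
          case 3
          obtain ts' w' where "del_leaf j s = Node (Leaf # t1' # ts')" "word_face j s vs = ([], x, q) # us1' @ w'"
            using face_rest[OF M(3) 3, of "([], x, q)" r ts] j(1) by (auto simp: s vs)
          then have "\<not> lower_tree (del_leaf j s) (word_face j s vs)"
            using eval_Node1(1)[of us1' t1' ts' "[]" x q w'] valid_deg(1)[OF M(3)] ne M(5) C(2) by simp
          then show ?thesis by simp
        qed
      qed (use M val C us0 i in \<open>auto simp: vs\<close>)
    next
      case D
      then have t1: "t1 = Leaf" using valid_Leaf_iff Node.hyps(2) by blast
      have "q \<noteq> []" using Node.prems(1) eval_Node1(1)[of us1 t1 ts p x q r] d1 us0 t0 D by simp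
      then obtain q' y where q: "q = q' @ [(y, False)]" using D(2) by (cases q rule: rev_cases) auto
      let ?bt = "Node [Leaf, Leaf]" and ?bu = "[([], y, [])] :: 'a mword list"
      have i: "i = 1" and s: "s = Node (Leaf # ?bt # ts)" and vs: "vs = ([], x, q') # ?bu @ r"
        using Node.prems(2) D us0 t0 t1 q by (auto simp: Let_def tree_degree_def)
      have val: "valid s vs"
        using valid.Node[OF valid.Leaf bullet, of ts r "[]" x q'] Node.hyps by (simp add: s vs)
      have w: "weight vs = weight ?us" using us0 D q by (simp add: vs)
      note second = face_second[OF bullet _ _ Node.hyps(4), of y _ "([], x, q')"]
      have nonlow: "\<not> lower_tree (Node (Leaf # ?bt # ts')) (([], x, q') # ?bu @ w')" for ts' w'
        using eval_Node1(1)[of ?bu ?bt ts' "[]" x q' w'] dbul bullet'[of y] D(2) q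
        by (auto simp del: lower_tree.simps)
      show ?thesis unfolding matched_def
      proof (intro conjI allI impI)
        show "\<not> lower_tree s vs" using nonlow by (simp add: s vs del: lower_tree.simps)
        show "del_leaf i s = ?t" by (simp add: s i t0 t1)
        show "word_face i s vs = ?us" using D us0 q by (simp add: s i vs word_face_def)
        fix j assume j: "j \<le> length vs" "j \<noteq> i"
        consider "j = 0" | "j = 2" | "length ?bu + 1 < j" using j(2) i by fastforce
        then show "\<not> lower_tree (del_leaf j s) (word_face j s vs) \<or> rank (del_leaf j s) (word_face j s vs) < rank ?t ?us"
        proof cases
          case 1
          then show ?thesis using outer[OF val w] by (simp add: vs)
        next
          case 2
          \<comment> \<open>The cherry is destroyed and its letter leaves to the right. This face
            may be lower; its rank is smaller because \<open>q'\<close> lacks the last letter of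
            \<open>q\<close>.\<close>
          obtain r' where "word_face (1 + 1) s vs = ([], x, q') # word_face 1 ?bt ?bu @ r'"
            unfolding s vs by (rule second[of 1]) auto
          moreover have "word_face 1 ?bt ?bu = []" by (simp add: word_face_def)
          moreover have j2: "j = 1 + 1" using 2 by simp
          ultimately have f: "del_leaf j s = Node (Leaf # Leaf # ts)" "word_face j s vs = ([], x, q') # [] @ r'"
            unfolding j2 by (simp_all add: s)
          have "rank (del_leaf j s) (word_face j s vs) = 2 ^ weight (word_face j s vs) + length q'"
            using eval_Node1(2)[of "[]" Leaf ts "[]" x q' r'] unfolding f by (simp add: tree_degree_def)
          moreover have "rank ?t ?us = 2 ^ weight ?us + length q"
            using eval_Node1(2)[of us1 t1 ts p x q r] d1 us0 t0 D by simp
          ultimately show ?thesis using rank_le[OF _ w, of "length q'" "length q" j s] j(1) q by (simp add: vs)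
        next
          case 3
          obtain ts' w' where "del_leaf j s = Node (Leaf # ?bt # ts')" "word_face j s vs = ([], x, q') # ?bu @ w'"
            using face_rest[OF bullet 3, of "([], x, q')" r ts] j(1) unfolding s vs by blast
          then show ?thesis using nonlow[of ts' w'] by (simp del: lower_tree.simps)
        qed
      qed (use val i D us0 q in \<open>auto simp: vs\<close>)
    qed
  qed
qed

text \<open>A generator on the cherry: this is upper but has no lower tree below it. As a subtree it
  is where the recursion stops and the new cut was made.\<close>

lemma valid_weight_one:
  assumes "valid t us" "weight us = 1"
  obtains y where "t = Node [Leaf, Leaf]" "us = [([], y, [])]"
proof -
  have "us \<noteq> []" "length us \<le> 1" using assms(2) length_le_weight[of us] by auto
  then obtain p y q where us: "us = [(p, y, q)]" by (cases us) auto
  from assms(1) show ?thesis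
  proof (cases rule: valid.cases)
    case Leaf
    then show ?thesis using us by simp
  next
    case (Node t0 us0 t1 us1 ts r p' x' q')
    have "length us = 1" using us by simp
    then have e: "us0 = []" "us1 = []" "r = []" unfolding Node(2) by simp_all
    have "ts = []"
    proof (cases ts)
      case (Cons t ts')
      then have "0 < leaves t" using Node leaves_pos by auto
      then show ?thesis using Node e Cons by simp
    qed simp
    moreover have "t0 = Leaf" "t1 = Leaf" using Node e valid_Leaf_iff by blast+
    ultimately show ?thesis using that us Node assms(2) by simp
  qed
qed

text \<open>Inverts \<open>upper_partner\<close>. A block with at least two letters is treated
  recursively; a block with one letter is a cherry, and its letter is put back into the prefix or
  the tail of the first word at the root.\<close>

lemma not_low_up:
  "valid t us \<Longrightarrow> \<not> lower_tree t us \<Longrightarrow> weight us \<ge> 2 \<Longrightarrow> \<exists>i s vs. valid s vs \<and> lower_tree s vs \<and> upper_partner s vs = (i, t, us)"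
proof (induction rule: valid.induct)
  case Leaf
  then show ?case by simp
next
  case (Node t0 us0 t1 us1 ts r p x q)
  note d0 = valid_deg[OF Node.hyps(1)] and d1 = valid_deg[OF Node.hyps(2)]
  have w_pos: "weight vs > 0" if "vs \<noteq> []" for vs :: "'a mword list"
    using length_le_weight[of vs] that by (cases vs) auto
  show ?case
  proof (cases "us0 = []")
    case us0: False
    then have low0: "\<not> lower_tree t0 us0" using Node.prems(1) eval_Node0(1)[of us0 t0] d0 by simp
    show ?thesis
    proof (cases "weight us0 \<ge> 2")
      case True
      then obtain i s0 vs0 where s0: "valid s0 vs0" "lower_tree s0 vs0" "upper_partner s0 vs0 = (i, t0, us0)"
        using Node.IH(1) low0 by blast
      then have ne: "vs0 \<noteq> []" by (auto elim: valid.cases)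
      have "valid (Node (s0 # t1 # ts)) (vs0 @ (p, x, q) # us1 @ r)"
        by (rule valid.Node) (use s0 Node.hyps in auto)
      moreover have "lower_tree (Node (s0 # t1 # ts)) (vs0 @ (p, x, q) # us1 @ r)"
        using eval_Node0(1)[of vs0 s0] valid_deg(1)[OF s0(1)] ne s0(2) by simp
      moreover have "upper_partner (Node (s0 # t1 # ts)) (vs0 @ (p, x, q) # us1 @ r) =
          (i, Node (t0 # t1 # ts), us0 @ (p, x, q) # us1 @ r)"
        using valid_deg(1)[OF s0(1)] ne s0(3) d1 by (simp add: Let_def)
      ultimately show ?thesis by blast
    next
      case False
      then have "weight us0 = 1" using w_pos[OF us0] by linarith
      then obtain y where y: "t0 = Node [Leaf, Leaf]" "us0 = [([], y, [])]"
        using valid_weight_one[OF Node.hyps(1)] by blast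
      have "valid (Node (Leaf # t1 # ts)) ((y # p, x, q) # us1 @ r)"
        using valid.Node[OF valid.Leaf Node.hyps(2-4), of "y # p" x q] by simp
      moreover have "lower_tree (Node (Leaf # t1 # ts)) ((y # p, x, q) # us1 @ r)"
        using eval_Node1(1)[of us1 t1] d1 by simp
      moreover have "upper_partner (Node (Leaf # t1 # ts)) ((y # p, x, q) # us1 @ r) =
          (1, Node (t0 # t1 # ts), us0 @ (p, x, q) # us1 @ r)"
        using d1 y by (simp add: Let_def tree_degree_def)
      ultimately show ?thesis by blast
    qed
  next
    case us0: True
    then have t0: "t0 = Leaf" using valid_Leaf_iff Node.hyps(1) by blast
    have p: "p = []" and q: "True \<notin> snd ` set q" and low1: "if us1 \<noteq> [] then \<not> lower_tree t1 us1 else q = []"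
      using Node.prems(1) eval_Node1(1)[of us1 t1 ts p x q r] d1 us0 t0 by (auto split: if_splits)
    show ?thesis
    proof (cases "us1 = []")
      case us1: False
      show ?thesis
      proof (cases "weight us1 \<ge> 2")
        case True
        then obtain i s1 vs1 where s1: "valid s1 vs1" "lower_tree s1 vs1" "upper_partner s1 vs1 = (i, t1, us1)"
          using Node.IH(2) low1 us1 by auto
        then have ne: "vs1 \<noteq> []" by (auto elim: valid.cases)
        have "valid (Node (Leaf # s1 # ts)) (([], x, q) # vs1 @ r)"
          using valid.Node[OF valid.Leaf s1(1) Node.hyps(3,4), of "[]" x q] by simp
        moreover have "lower_tree (Node (Leaf # s1 # ts)) (([], x, q) # vs1 @ r)"
          using eval_Node1(1)[of vs1 s1] valid_deg(1)[OF s1(1)] ne s1(2) by simp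
        moreover have "upper_partner (Node (Leaf # s1 # ts)) (([], x, q) # vs1 @ r) =
            (i + 1, Node (t0 # t1 # ts), us0 @ (p, x, q) # us1 @ r)"
          using valid_deg(1)[OF s1(1)] ne s1(3) q us0 t0 p by (simp add: Let_def tree_degree_def)
        ultimately show ?thesis by blast
      next
        case False
        then have "weight us1 = 1" using w_pos[OF us1] by linarith
        then obtain y where y: "t1 = Node [Leaf, Leaf]" "us1 = [([], y, [])]"
          using valid_weight_one[OF Node.hyps(2)] by blast
        let ?q = "q @ [(y, False)]"
        have "valid (Node (Leaf # Leaf # ts)) (([], x, ?q) # r)"
          using valid.Node[OF valid.Leaf valid.Leaf Node.hyps(3,4), of "[]" x ?q] by simp
        moreover have "lower_tree (Node (Leaf # Leaf # ts)) (([], x, ?q) # r)"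
          by (simp add: Let_def tree_degree_def)
        moreover have "upper_partner (Node (Leaf # Leaf # ts)) (([], x, ?q) # r) =
            (1, Node (t0 # t1 # ts), us0 @ (p, x, q) # us1 @ r)"
          using q us0 t0 p y by (simp add: Let_def tree_degree_def image_Un)
        ultimately show ?thesis by blast
      qed
    next
      case us1: True
      then have t1: "t1 = Leaf" and q': "q = []" using valid_Leaf_iff Node.hyps(2) low1 by auto
      \<comment> \<open>The first word is a single letter, so the second letter lies in
        \<open>r\<close> and the root has a third subtree. Deleting the middle leaf
        \<open>t1\<close> undoes a \<open>Mid\<close> cut, and \<open>t2\<close> becomes the second
        subtree.\<close>
      then have "r \<noteq> []" using Node.prems(2) us0 us1 p by auto
      then obtain t2 ts' where ts: "ts = t2 # ts'" using Node.hyps(4) by (cases ts) auto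
      have t2: "wf_tree t2" "leaves t2 > 0" using Node.hyps(3) ts leaves_pos by auto
      obtain p2 y q2 r' where r: "r = (p2, y, q2) # r'" using \<open>r \<noteq> []\<close> by (cases r) auto
      define us2 r2 where "us2 = take (leaves t2 - 1) r'" and "r2 = drop (leaves t2 - 1) r'"
      have len: "length r' = leaves t2 - 1 + sum_list (map leaves ts')"
        using Node.hyps(4) ts r t2(2) by simp
      have r': "r' = us2 @ r2" by (simp add: us2_def r2_def)
      have v2: "valid t2 us2" using t2 len by (intro trees_valid) (auto simp: us2_def trees_def)
      let ?q = "unmark p2 @ (y, True) # q2"
      have sp: "split_mark ?q = (p2, y, q2)"
        by (simp add: split_mark_def Let_def unmark_def takeWhile_append dropWhile_append o_def)
      have "valid (Node (Leaf # t2 # ts')) (([], x, ?q) # us2 @ r2)"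
        using valid.Node[OF valid.Leaf v2, of ts' r2 "[]" x ?q] Node.hyps(3) ts len by (simp add: r2_def)
      moreover have "lower_tree (Node (Leaf # t2 # ts')) (([], x, ?q) # us2 @ r2)"
        using eval_Node1(1)[of us2 t2] valid_deg(1)[OF v2] by simp
      moreover have "upper_partner (Node (Leaf # t2 # ts')) (([], x, ?q) # us2 @ r2) =
          (1, Node (t0 # t1 # ts), us0 @ (p, x, q) # us1 @ r)"
        using valid_deg(1)[OF v2] us0 t0 p us1 t1 q' ts r r' sp by (simp add: Let_def tree_degree_def)
      ultimately show ?thesis by blast
    qed
  qed
qed

section \<open>Vanishing of the cohomology\<close>

lemma tree_op_inner: "0 < i \<Longrightarrow> i < tree_degree t \<Longrightarrow> tree_op i t = leaf_op i t"
  by (simp add: tree_op_def)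

definition word_letters :: "'v mword list \<Rightarrow> 'v set" where
  "word_letters us = set (concat (map letters us))"

lemma word_letters_word_face: "us \<noteq> [] \<Longrightarrow> word_letters (word_face i t us) \<subseteq> word_letters us"
proof (cases "0 < i \<and> i < length us")
  case True
  then show ?thesis using letters_word_face_merge[of i us t] by (simp add: word_letters_def)
next
  case False
  then show ?thesis by (auto simp: word_letters_def word_face_def dest: in_set_butlastD list.set_sel(2)
    split: if_splits)
qed

locale triassociative_module_basis = triassociative_module sA pr sM lact ract
  for sA :: "'k::field \<Rightarrow> 'a::ab_group_add \<Rightarrow> 'a" and pr and sM :: "'k \<Rightarrow> 'm::ab_group_add \<Rightarrow> 'm"
    and lact ract +
  fixes ev :: "'v mword \<Rightarrow> 'a" and h :: "'a \<Rightarrow> ('v mword \<Rightarrow>\<^sub>0 'k)" and B :: "'v set"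
  assumes h_linear: "Vector_Spaces.linear sA pm_scale h"
    and h_ev: "set (letters w) \<subseteq> B \<Longrightarrow> h (ev w) = Poly_Mapping.single w 1"
    and ev_h: "a = pm_eval sA ev (h a)"
    and keys_h: "w \<in> Poly_Mapping.keys (h a) \<Longrightarrow> set (letters w) \<subseteq> B"
    and ev_mul: "ev (mw_mul c u w) = pr c (ev u) (ev w)"
begin

section \<open>The coboundary on basis words and its recursive solution\<close>

definition act :: "nat \<Rightarrow> ptree \<Rightarrow> 'v mword list \<Rightarrow> 'm \<Rightarrow> 'm" where
  "act j t us m = (if j = 0 then lact (tree_op 0 t) (ev (hd us)) m
     else if j < length us then m else ract (tree_op (length us) t) m (ev (last us)))"

lemma act_zero [simp]: "act j t us 0 = 0"
  using bilinear_opD[OF bilinear(2)] bilinear_opD[OF bilinear(3)] by (simp add: act_def)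

lemma coface_ev:
  assumes "valid t us" "length us = n + 1" "j \<le> n + 1"
  shows "coface pr lact ract n j f t (map ev us) = act j t us (f (del_leaf j t) (map ev (word_face j t us)))"
proof -
  have "us \<noteq> []" using assms(2) by auto
  consider "j = 0" | "0 < j" "j \<le> n" | "j = n + 1" using assms(3) by linarith
  then show ?thesis
  proof cases
    case 2
    then have "tree_op j t = leaf_op j t" using valid_deg(1)[OF assms(1)] assms(2) by (simp add: tree_op_inner)
    then show ?thesis using 2 assms(2)
      by (simp add: coface_def act_def word_face_def ev_mul take_map drop_map)
  qed (use assms \<open>us \<noteq> []\<close> in \<open>simp_all add: coface_def act_def word_face_def map_tl map_butlast hd_map last_map\<close>)
qed

lemma coboundary_ev:
  assumes "valid t us" "length us = n + 1"
  shows "coboundary pr sM lact ract n f t (map ev us) =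
    (\<Sum>j\<le>length us. sM ((- 1) ^ j) (act j t us (f (del_leaf j t) (map ev (word_face j t us)))))"
  using valid_trees[OF assms(1)] assms(2) coface_ev[OF assms]
  by (simp add: coboundary_def del: sum.atMost_Suc)

text \<open>Solves the coboundary equation at the partner \<open>(s, vs)\<close> for its term of
  index \<open>i\<close>. The descent of \<open>rank\<close> is available only for valid lower
  trees, so the recursion runs on fuel \<open>k\<close>.\<close>

primrec primitive_approx ::
  "(ptree \<Rightarrow> 'a list \<Rightarrow> 'm) \<Rightarrow> nat \<Rightarrow> ptree \<Rightarrow> 'v mword list \<Rightarrow> 'm" where
  "primitive_approx f 0 t us = 0"
| "primitive_approx f (Suc k) t us = (if lower_tree t us then case upper_partner t us of (i, s, vs) \<Rightarrow>
     sM ((- 1) ^ i) (f s (map ev vs) - (\<Sum>j\<in>{..length vs} - {i}.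
       sM ((- 1) ^ j) (act j s vs (primitive_approx f k (del_leaf j s) (word_face j s vs))))) else 0)"

lemma primitive_approx_not_low: "\<not> lower_tree t us \<Longrightarrow> primitive_approx f k t us = 0"
  by (cases k) auto

text \<open>With fuel above the rank nothing is cut short: lower faces of the partner have smaller
  rank, and upper ones have the value 0.\<close>

lemma primitive_approx_stable:
  "valid t us \<Longrightarrow> rank t us < k \<Longrightarrow> primitive_approx f k t us = primitive_approx f (Suc k) t us"
proof (induction k arbitrary: t us)
  case (Suc k)
  show ?case
  proof (cases "lower_tree t us")
    case True
    obtain i s vs where up: "upper_partner t us = (i, s, vs)" by (metis prod_cases3)
    note M = up_matched[OF Suc.prems(1) True up, unfolded matched_def]
    have "primitive_approx f k (del_leaf j s) (word_face j s vs) =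
        primitive_approx f (Suc k) (del_leaf j s) (word_face j s vs)" if "j \<in> {..length vs} - {i}" for j
    proof (cases "lower_tree (del_leaf j s) (word_face j s vs)")
      case True
      have "vs \<noteq> []" using M by auto
      have "rank (del_leaf j s) (word_face j s vs) < rank t us" using M True that by auto
      then show ?thesis using Suc.IH[OF valid_word_face[of s vs j]] M that Suc.prems(2) \<open>vs \<noteq> []\<close> by simp
    next
      case False
      then show ?thesis by (simp add: primitive_approx_not_low del: primitive_approx.simps)
    qed
    then have "(\<Sum>j\<in>{..length vs} - {i}.
        sM ((- 1) ^ j) (act j s vs (primitive_approx f k (del_leaf j s) (word_face j s vs)))) =
      (\<Sum>j\<in>{..length vs} - {i}.
        sM ((- 1) ^ j) (act j s vs (primitive_approx f (Suc k) (del_leaf j s) (word_face j s vs))))"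
      by (intro sum.cong refl) simp
    then show ?thesis using True up
      unfolding primitive_approx.simps(2)[of f k t us] primitive_approx.simps(2)[of f "Suc k" t us] by simp
  next
    case False
    then show ?thesis by (simp add: primitive_approx_not_low del: primitive_approx.simps)
  qed
qed simp

definition primitive_on_words :: "(ptree \<Rightarrow> 'a list \<Rightarrow> 'm) \<Rightarrow> ptree \<Rightarrow> 'v mword list \<Rightarrow> 'm" where
  "primitive_on_words f t us = primitive_approx f (Suc (rank t us)) t us"

lemma primitive_approx_eq:
  assumes "valid t us" "rank t us < k"
  shows "primitive_approx f k t us = primitive_on_words f t us"
  using assms(2)
proof (induction k)
  case (Suc k)
  then show ?case using primitive_approx_stable[OF assms(1), of k f]
    by (cases "rank t us = k") (simp_all add: primitive_on_words_def del: primitive_approx.simps)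
qed simp

lemma sM_sign_sign: "sM ((- 1) ^ i) (sM ((- 1) ^ i) x) = x"
  by (simp add: sM_minus_one)

lemma primitive_on_words_boundary:
  assumes "valid t us" "lower_tree t us" "upper_partner t us = (i, s, vs)"
  shows "(\<Sum>j\<le>length vs. sM ((- 1) ^ j)
    (act j s vs (primitive_on_words f (del_leaf j s) (word_face j s vs)))) = f s (map ev vs)"
proof -
  note M = up_matched[OF assms, unfolded matched_def]
  let ?X = "\<lambda>j. sM ((- 1) ^ j) (act j s vs (primitive_on_words f (del_leaf j s) (word_face j s vs)))"
  let ?S = "\<Sum>j\<in>{..length vs} - {i}. ?X j"
  have "vs \<noteq> []" using M by auto
  \<comment> \<open>The fuel \<open>Suc (rank t us)\<close> leaves \<open>rank t us\<close> for the
    faces, which exceeds the rank of each lower one.\<close>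
  have "primitive_approx f (rank t us) (del_leaf j s) (word_face j s vs) =
      primitive_on_words f (del_leaf j s) (word_face j s vs)" if "j \<in> {..length vs} - {i}" for j
  proof (cases "lower_tree (del_leaf j s) (word_face j s vs)")
    case True
    then have "rank (del_leaf j s) (word_face j s vs) < rank t us" using M that by auto
    then show ?thesis using primitive_approx_eq[OF valid_word_face[of s vs j]] M that \<open>vs \<noteq> []\<close> by simp
  next
    case False
    then show ?thesis
      by (simp add: primitive_approx_not_low primitive_on_words_def del: primitive_approx.simps)
  qed
  then have "(\<Sum>j\<in>{..length vs} - {i}. sM ((- 1) ^ j)
      (act j s vs (primitive_approx f (rank t us) (del_leaf j s) (word_face j s vs)))) = ?S"
    by (intro sum.cong refl) simp
  then have "primitive_on_words f t us = sM ((- 1) ^ i) (f s (map ev vs) - ?S)"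
    using assms by (simp add: primitive_on_words_def)
  then have "sM ((- 1) ^ i) (act i s vs (primitive_on_words f (del_leaf i s) (word_face i s vs))) =
      f s (map ev vs) - ?S"
    using M by (simp add: act_def sM_sign_sign)
  moreover have "(\<Sum>j\<le>length vs. ?X j) = ?X i + ?S" by (rule sum.remove) (use M in auto)
  ultimately show ?thesis by simp
qed

definition primitive :: "nat \<Rightarrow> (ptree \<Rightarrow> 'a list \<Rightarrow> 'm) \<Rightarrow> ptree \<Rightarrow> 'a list \<Rightarrow> 'm" where
  "primitive m f t as = (if t \<in> trees m \<and> length as = m
     then multilinear_extension sM h (primitive_on_words f t) as else 0)"

lemma primitive_cochains: "primitive m f \<in> cochains sA sM m"
  using multilinear_extension_linear[OF h_linear M.vector_space_axioms]
  by (auto simp: cochains_def primitive_def)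

lemma primitive_ev:
  assumes "valid t us" "word_letters us \<subseteq> B" "length us = m"
  shows "primitive m f t (map ev us) = primitive_on_words f t us"
  using multilinear_extension_basis[of us h ev sM "primitive_on_words f t", OF _ M.vector_space_axioms]
    h_ev assms valid_trees[OF assms(1)]
  by (auto simp: primitive_def word_letters_def UN_subset_iff)

lemma coboundary_diff:
  "coboundary pr sM lact ract n (\<lambda>t as. f t as - g t as) t as =
    coboundary pr sM lact ract n f t as - coboundary pr sM lact ract n g t as"
proof -
  have "coface pr lact ract n i (\<lambda>t as. f t as - g t as) t as =
      coface pr lact ract n i f t as - coface pr lact ract n i g t as" for i
  proof -
    interpret l: Vector_Spaces.linear sM sM "lact c x" for c x
      using bilinear(2) by (simp add: bilinear_op_def)
    interpret r: Vector_Spaces.linear sM sM "\<lambda>m. ract c m x" for c x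
      using bilinear(3) by (simp add: bilinear_op_def)
    show ?thesis by (simp add: coface_def l.diff r.diff)
  qed
  then show ?thesis
    by (simp add: coboundary_def M.scale_right_diff_distrib sum_subtractf del: sum.atMost_Suc)
qed

lemma cocycle_is_coboundary:
  assumes m: "m \<ge> 1" and f: "f \<in> cochains sA sM (m + 1)"
    and cocycle: "coboundary pr sM lact ract (m + 1) f = (\<lambda>t as. 0)"
  shows "f = coboundary pr sM lact ract m (primitive m f)"
proof -
  define g where "g = coboundary pr sM lact ract m (primitive m f)"
  define e where "e = (\<lambda>t as. f t as - g t as)"
  have g: "g \<in> cochains sA sM (m + 1)" unfolding g_def by (rule coboundary_cochains[OF primitive_cochains])
  have de: "coboundary pr sM lact ract (m + 1) e t as = 0" for t as
    unfolding e_def coboundary_diff cocycle g_def coboundary_coboundary[OF m] by simp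
  have upper: "e t (map ev us) = 0"
    if v: "valid t us" "length us = m + 1" "word_letters us \<subseteq> B" "\<not> lower_tree t us" for t us
  proof -
    \<comment> \<open>Each word has a letter, so from degree 2 on there are at least two letters and
      every upper tree is a partner.\<close>
    have "weight us \<ge> 2" using length_le_weight[of us] v(2) m by linarith
    then obtain i s vs where s: "valid s vs" "lower_tree s vs" "upper_partner s vs = (i, t, us)"
      using not_low_up v by blast
    have "us \<noteq> []" using v(2) by auto
    have "g t (map ev us) = (\<Sum>j\<le>length us. sM ((- 1) ^ j)
        (act j t us (primitive_on_words f (del_leaf j t) (word_face j t us))))"
      unfolding g_def coboundary_ev[OF v(1,2)]
    proof (intro sum.cong refl)
      fix j assume "j \<in> {..length us}"
      then have "primitive m f (del_leaf j t) (map ev (word_face j t us)) =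
          primitive_on_words f (del_leaf j t) (word_face j t us)"
        using valid_word_face[OF v(1) \<open>us \<noteq> []\<close>] order_trans[OF word_letters_word_face[OF \<open>us \<noteq> []\<close>] v(3)] v(2)
        by (intro primitive_ev) (auto simp: length_word_face[OF \<open>us \<noteq> []\<close>])
      then show "sM ((- 1) ^ j) (act j t us (primitive m f (del_leaf j t) (map ev (word_face j t us)))) =
          sM ((- 1) ^ j) (act j t us (primitive_on_words f (del_leaf j t) (word_face j t us)))"
        by simp
    qed
    then show ?thesis using primitive_on_words_boundary[OF s] by (simp add: e_def)
  qed
  have zero: "e t (map ev us) = 0" if "valid t us" "length us = m + 1" "word_letters us \<subseteq> B" for t us
    using that
  proof (induction "rank t us" arbitrary: t us rule: less_induct)
    case less
    show ?case
    proof (cases "lower_tree t us")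
      case True
      obtain i s vs where up: "upper_partner t us = (i, s, vs)" by (metis prod_cases3)
      note M = up_matched[OF less.prems(1) True up, unfolded matched_def]
      let ?X = "\<lambda>j. sM ((- 1) ^ j) (act j s vs (e (del_leaf j s) (map ev (word_face j s vs))))"
      have "vs \<noteq> []" using M by auto
      have W: "word_letters vs \<subseteq> B" using M less.prems(3) by (simp add: word_letters_def)
      have "e (del_leaf j s) (map ev (word_face j s vs)) = 0" if "j \<in> {..length vs} - {i}" for j
      proof -
        have f: "valid (del_leaf j s) (word_face j s vs)" "length (word_face j s vs) = m + 1"
          "word_letters (word_face j s vs) \<subseteq> B"
          using valid_word_face[of s vs j] word_letters_word_face[OF \<open>vs \<noteq> []\<close>, of j s] M that W \<open>vs \<noteq> []\<close>
            less.prems(2) by (auto simp: length_word_face)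
        show ?thesis
        proof (cases "lower_tree (del_leaf j s) (word_face j s vs)")
          case True
          then have "rank (del_leaf j s) (word_face j s vs) < rank t us" using M that by auto
          then show ?thesis using less.hyps f by blast
        qed (use upper f in blast)
      qed
      then have "(\<Sum>j\<in>{..length vs} - {i}. ?X j) = 0" by (intro sum.neutral) simp
      moreover have "(\<Sum>j\<le>length vs. ?X j) = ?X i + (\<Sum>j\<in>{..length vs} - {i}. ?X j)"
        by (rule sum.remove) (use M in auto)
      moreover have "coboundary pr sM lact ract (m + 1) e s (map ev vs) = (\<Sum>j\<le>length vs. ?X j)"
        by (rule coboundary_ev) (use M less.prems(2) in auto)
      \<comment> \<open>Only the inner face \<open>i\<close> survives at the partner, and there
        \<open>act\<close> is the identity.\<close>
      ultimately have "coboundary pr sM lact ract (m + 1) e s (map ev vs) = ?X i" by simp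
      then have "sM ((- 1) ^ i) (e t (map ev us)) = 0" using de M by (simp add: act_def)
      then show ?thesis by (simp add: sM_minus_one split: if_splits)
    qed (use upper less.prems in blast)
  qed
  have "f t (map ev us) = g t (map ev us)"
    if "t \<in> trees (m + 1)" "us \<in> lists {w. set (letters w) \<subseteq> B}" "length us = m + 1" for t us
    using zero[of t us] trees_valid[of t us] that by (force simp: e_def word_letters_def)
  then show ?thesis unfolding g_def[symmetric]
    by (intro cochains_eq_on_basis[OF f g ev_h, of "{w. set (letters w) \<subseteq> B}"]) (auto dest: keys_h)
qed

lemma coboundary_zero: "coboundary pr sM lact ract n (\<lambda>t as. 0) = (\<lambda>t as. 0)"
  using coboundary_diff[of n "\<lambda>t as. 0" "\<lambda>t as. 0"] by (intro ext) simp

lemma cohomology_vanishes: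
  assumes "n \<ge> 2"
  shows "H_Trias sA pr sM lact ract n = {cohomology_class sA pr sM lact ract n (\<lambda>t as. 0)}"
proof -
  obtain m where n: "n = m + 1" and m: "m \<ge> 1" using assms by (cases n) auto
  have zero: "(\<lambda>t as. 0) \<in> cochains sA sM k" for k
    using cochains_diff[OF primitive_cochains[of k undefined] primitive_cochains[of k undefined]] by simp
  have "cohomology_class sA pr sM lact ract n f = cohomology_class sA pr sM lact ract n (\<lambda>t as. 0)"
    if f: "f \<in> cocycles sA pr sM lact ract n" for f
  proof -
    obtain g where g: "g \<in> cochains sA sM m" "f = coboundary pr sM lact ract m g"
      using f cocycle_is_coboundary[OF m] primitive_cochains by (auto simp: cocycles_def n)
    have B: "coboundaries sA pr sM lact ract n = coboundary pr sM lact ract m ` cochains sA sM m" by (simp add: n)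
    \<comment> \<open>Coboundaries form a group that contains \<open>f\<close>, so adding all of
      them to \<open>f\<close> or to 0 gives the same set.\<close>
    have diff: "(\<lambda>t as. b t as - c t as) \<in> coboundaries sA pr sM lact ract n"
      if bc: "b \<in> coboundaries sA pr sM lact ract n" "c \<in> coboundaries sA pr sM lact ract n" for b c
    proof -
      obtain b' c' where bc': "b' \<in> cochains sA sM m" "c' \<in> cochains sA sM m"
        "b = coboundary pr sM lact ract m b'" "c = coboundary pr sM lact ract m c'"
        using bc unfolding B by blast
      have "(\<lambda>t as. b t as - c t as) = coboundary pr sM lact ract m (\<lambda>t as. b' t as - c' t as)"
        by (intro ext) (simp add: bc' coboundary_diff)
      then show ?thesis unfolding B using cochains_diff[OF bc'(1,2)] by blast
    qed
    have fB: "f \<in> coboundaries sA pr sM lact ract n" unfolding B using g by blast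
    have "(\<lambda>t as. 0) \<in> coboundaries sA pr sM lact ract n" using diff[OF fB fB] by simp
    then have neg: "(\<lambda>t as. - f t as) \<in> coboundaries sA pr sM lact ract n" using diff fB by fastforce
    show ?thesis unfolding cohomology_class_def
    proof safe
      fix b assume b: "b \<in> coboundaries sA pr sM lact ract n"
      have "(\<lambda>t as. f t as + b t as) \<in> coboundaries sA pr sM lact ract n" using diff[OF b neg] by (simp add: add.commute)
      then show "\<exists>c. (\<lambda>t as. f t as + b t as) = (\<lambda>t as. 0 + c t as) \<and> c \<in> coboundaries sA pr sM lact ract n"
        by (intro exI conjI) auto
      show "\<exists>c. (\<lambda>t as. 0 + b t as) = (\<lambda>t as. f t as + c t as) \<and> c \<in> coboundaries sA pr sM lact ract n"
        using diff[OF b fB] by (intro exI[of _ "\<lambda>t as. b t as - f t as"]) simp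
    qed
  qed
  moreover have "(\<lambda>t as. 0) \<in> cocycles sA pr sM lact ract n"
    using zero coboundary_zero by (simp add: cocycles_def)
  ultimately show ?thesis unfolding H_Trias_def by blast
qed

end

theorem theorem2p8:
  fixes sV :: "'k::field \<Rightarrow> 'v::ab_group_add \<Rightarrow> 'v"
    and sA :: "'k \<Rightarrow> 'a::ab_group_add \<Rightarrow> 'a" and pr :: "triop \<Rightarrow> 'a \<Rightarrow> 'a \<Rightarrow> 'a"
    and \<iota> :: "'v \<Rightarrow> 'a"
    and sM :: "'k \<Rightarrow> 'm::ab_group_add \<Rightarrow> 'm"
    and lact :: "triop \<Rightarrow> 'a \<Rightarrow> 'm \<Rightarrow> 'm" and ract :: "triop \<Rightarrow> 'm \<Rightarrow> 'a \<Rightarrow> 'm"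
    and n :: nat
  assumes "free_triassociative_algebra sV sA pr \<iota>"
    and "triassociative_representation sA pr sM lact ract"
    and "n \<ge> 2"
  shows "H_Trias sA pr sM lact ract n = {cohomology_class sA pr sM lact ract n (\<lambda>\<psi> as. 0)}"
proof -
  have A: "triassociative_algebra sA pr" using assms(1) by (simp add: free_triassociative_algebra_def)
  then have tri: "triassoc pr pr pr pr" by (simp add: triassociative_algebra_def)
  show ?thesis
  proof (rule free_algebra_basis[OF assms(1)])
    fix B and h :: "'a \<Rightarrow> ('v mword \<Rightarrow>\<^sub>0 'k)"
    assume basis: "Vector_Spaces.linear sA pm_scale h"
      "\<And>w. set (letters w) \<subseteq> B \<Longrightarrow> h (mw_eval pr \<iota> w) = Poly_Mapping.single w 1"
      "\<And>a. a = pm_eval sA (mw_eval pr \<iota>) (h a)"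
      "\<And>a w. w \<in> Poly_Mapping.keys (h a) \<Longrightarrow> set (letters w) \<subseteq> B"
    interpret triassociative_module_basis sA pr sM lact ract "mw_eval pr \<iota>" h B
      by (intro triassociative_module_basis.intro triassociative_module.intro
          triassociative_module_basis_axioms.intro)
        (rule A assms(2) basis mw_eval_mul[OF tri]; assumption?)+
    show ?thesis by (rule cohomology_vanishes[OF assms(3)])
  qed
qed

end
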